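(* Let $\sigma>0$ and $\delta>0$ be fixed. For each integer $N\ge 2$ let $x(t)=(x_1(t),\ldots,x_N(t))$, $t\ge 0$, be the system of $N$ Brownian particles with diffusion coefficient $\sigma$ and pairwise synchronizing jumps at the epochs of a Poisson flow of intensity $\delta$ (defined in the context), let $R_N(t)=\mathsf{E}\,V(x(t))$, and let $\varkappa=2$. Suppose $\sup_N R_N(0)<\infty$. Let $N\to\infty$ and $t=t(N)\to\infty$. Then: I. If $\dfrac{t(N)}{N^2}\to 0$, then $R_N(t(N))\sim \sigma^2\,t(N)$. II. If $t(N)=cN^2/(\varkappa\delta)$ with a constant $c>0$, then $R_N(t(N))\sim \dfrac{1-e^{-c}}{c}\,\sigma^2\,t(N)$. III. If $\dfrac{t(N)}{N^2}\to\infty$, then $R_N(t(N))\sim\left(\dfrac{\sigma^2}{\varkappa\delta}\right)N^2$.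
   Context: Definition of the process. Fix $N\ge 2$ and $\mathcal{N}_N=\{1,\ldots,N\}$. On a probability space let the following be given: (a) a standard $N$-dimensional Brownian motion $B(t)=(B_1(t),\ldots,B_N(t))$; (b) random times $0=\tau_0<\tau_1<\tau_2<\cdots$ such that the increments $\tau_n-\tau_{n-1}$, $n\ge 1$, are independent and exponentially distributed, $\mathsf{P}(\tau_n-\tau_{n-1}>s)=\exp(-\delta s)$ (epochs of a Poisson flow of intensity $\delta$); (c) a random initial configuration $x(0)=(x_1(0),\ldots,x_N(0))\in\mathbb{R}^N$; (d) a sequence $(i_1,j_1),(i_2,j_2),\ldots$ of independent random ordered pairs, each uniformly distributed over the ordered pairs $(i,j)$ with $i,j\in\mathcal{N}_N$, $i\ne j$. The objects in (a), (b), (c), (d) are mutually independent. The process $x(t)$ has right-continuous trajectories and satisfies: - free motion: for all $n\ge 0$, $s\in[\tau_n,\tau_{n+1})$ and $k\in\mathcal{N}_N$, $x_k(s)-x_k(\tau_n)=\sigma\,(B_k(s)-B_k(\tau_n))$; - synchronizing jumps: for all $n\ge 1$, $x_{j_n}(\tau_n)=x_{i_n}(\tau_n-0)$ and $x_m(\tau_n)=x_m(\tau_n-0)$ for all $m\in\mathcal{N}_N\setminus\{j_n\}$. For $x\in\mathbb{R}^N$ put $M(x)=\frac1N\sum_{m=1}^N x_m$ and $V(x)=\frac{1}{N-1}\sum_{m=1}^N (x_m-M(x))^2$. Finally $R_N(t)=\mathsf{E}\,V(x(t))$. The notation $a_N\sim b_N$ means $a_N/b_N\to 1$ as $N\to\infty$.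 *)

theory Defs
  imports "HOL-Probability.Probability" "HOL-Library.Landau_Symbols"
begin

text \<open>
  The \<open>\<sigma>\<close>-algebra on \<open>space M\<close> generated by a family of random elements \<open>X i\<close>, \<open>i \<in> I\<close>,
  all taking values in the measurable space \<open>S\<close>.
\<close>

definition generated_events :: "'a measure \<Rightarrow> 'b measure \<Rightarrow> 'i set \<Rightarrow> ('i \<Rightarrow> 'a \<Rightarrow> 'b) \<Rightarrow> 'a set set" where
  "generated_events M S I X =
     sets (vimage_algebra (space M) (\<lambda>\<omega>. \<lambda>i\<in>I. X i \<omega>) (\<Pi>\<^sub>M i\<in>I. S))"

definition ordered_pairs :: "nat \<Rightarrow> (nat \<times> nat) set" where
  "ordered_pairs N = {(i, j). i \<in> {1..N} \<and> j \<in> {1..N} \<and> i \<noteq> j}"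

definition center_of_mass :: "nat \<Rightarrow> (nat \<Rightarrow> real) \<Rightarrow> real" where
  "center_of_mass N y = (\<Sum>m=1..N. y m) / real N"

definition sample_variance :: "nat \<Rightarrow> (nat \<Rightarrow> real) \<Rightarrow> real" where
  "sample_variance N y = (\<Sum>m=1..N. (y m - center_of_mass N y)\<^sup>2) / (real N - 1)"

text \<open>
  Expectation of the nonnegative random variable \<open>sample_variance N (x t)\<close>, with values in
  \<open>[0, \<infinity>]\<close>, so that no integrability has to be presupposed. An asymptotic equivalence of
  \<open>enn2real (mean_variance \<dots>)\<close> with an eventually nonzero sequence also asserts eventual finiteness,
  since \<open>enn2real \<infinity> = 0\<close>.
\<close>

definition mean_variance ::
    "'a measure \<Rightarrow> nat \<Rightarrow> (nat \<Rightarrow> real \<Rightarrow> 'a \<Rightarrow> real) \<Rightarrow> real \<Rightarrow> ennreal" where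
  "mean_variance M N x t = (\<integral>\<^sup>+\<omega>. ennreal (sample_variance N (\<lambda>k. x k t \<omega>)) \<partial>M)"

text \<open>
  Standard Brownian motion with coordinates indexed by \<open>K\<close>. The assumption \<open>bm_indep\<close> is joint in
  coordinates and time steps: it contains both the independence of the increments of the vector
  process over disjoint intervals and the independence of the coordinates. Only nonnegative times
  are constrained.
\<close>

locale standard_brownian_motion = prob_space M
  for M :: "'a measure" and K :: "'k set" and B :: "'k \<Rightarrow> real \<Rightarrow> 'a \<Rightarrow> real" +
  assumes bm_measurable: "\<And>k t. k \<in> K \<Longrightarrow> 0 \<le> t \<Longrightarrow> random_variable borel (B k t)"
    and bm_start: "\<And>k. k \<in> K \<Longrightarrow> AE \<omega> in M. B k 0 \<omega> = 0"
    and bm_increments: "\<And>k s t. k \<in> K \<Longrightarrow> 0 \<le> s \<Longrightarrow> s < t \<Longrightarrow>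
      distributed M lborel (\<lambda>\<omega>. B k t \<omega> - B k s \<omega>) (normal_density 0 (sqrt (t - s)))"
    and bm_indep: "\<And>(n::nat) T. 0 \<le> T 0 \<Longrightarrow> strict_mono_on {..n} T \<Longrightarrow>
      indep_vars (\<lambda>_. borel) (\<lambda>(k, l) \<omega>. B k (T (Suc l)) \<omega> - B k (T l) \<omega>) (K \<times> {..<n})"
    and bm_continuous: "\<And>k. k \<in> K \<Longrightarrow> AE \<omega> in M. continuous_on {0..} (\<lambda>t. B k t \<omega>)"

text \<open>
  Here \<open>p n \<omega>\<close> is the random pair \<open>(i\<^sub>n, j\<^sub>n)\<close> and \<open>x k t \<omega>\<close> the position of particle \<open>k\<close> at
  time \<open>t\<close>. Pathwise properties are required almost surely. A left limit such as
  \<open>x\<^sub>j(\<tau>\<^sub>n) = x\<^sub>i(\<tau>\<^sub>n - 0)\<close> is expressed as convergence along \<open>at_left\<close>, which includes its existence.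
\<close>

locale synchronized_particles =
  standard_brownian_motion M "{1..N}" B
  for M :: "'a measure" and N :: nat and B :: "nat \<Rightarrow> real \<Rightarrow> 'a \<Rightarrow> real" +
  fixes \<sigma> \<delta> :: real
    and \<tau> :: "nat \<Rightarrow> 'a \<Rightarrow> real"
    and p :: "nat \<Rightarrow> 'a \<Rightarrow> nat \<times> nat"
    and x :: "nat \<Rightarrow> real \<Rightarrow> 'a \<Rightarrow> real"
  assumes \<tau>_measurable: "\<And>n. random_variable borel (\<tau> n)"
    and \<tau>_increasing: "AE \<omega> in M. \<tau> 0 \<omega> = 0 \<and> strict_mono (\<lambda>n. \<tau> n \<omega>)"
    and \<tau>_increments: "\<And>n. n \<ge> 1 \<Longrightarrow>
      distributed M lborel (\<lambda>\<omega>. \<tau> n \<omega> - \<tau> (n - 1) \<omega>) (exponential_density \<delta>)"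
    and \<tau>_indep: "indep_vars (\<lambda>_. borel) (\<lambda>n \<omega>. \<tau> n \<omega> - \<tau> (n - 1) \<omega>) {1..}"
    and p_measurable: "\<And>n. n \<ge> 1 \<Longrightarrow> random_variable (count_space UNIV) (p n)"
    and p_uniform: "\<And>n. n \<ge> 1 \<Longrightarrow>
      distr M (count_space UNIV) (p n) = measure_pmf (pmf_of_set (ordered_pairs N))"
    and p_indep: "indep_vars (\<lambda>_. count_space UNIV) p {1..}"
    and x_measurable: "\<And>k t. k \<in> {1..N} \<Longrightarrow> 0 \<le> t \<Longrightarrow> random_variable borel (x k t)"
    and mutual_indep: "indep_sets ((!)
      [generated_events M borel ({1..N} \<times> {0..}) (\<lambda>(k, t). B k t),
       generated_events M borel UNIV \<tau>,
       generated_events M borel {1..N} (\<lambda>k. x k 0),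
       generated_events M (count_space UNIV) {1..} p]) {..<4}"
    and right_continuous: "AE \<omega> in M. \<forall>k\<in>{1..N}. \<forall>t\<ge>0.
      continuous (at_right t) (\<lambda>s. x k s \<omega>)"
    and free_motion: "AE \<omega> in M. \<forall>n. \<forall>s\<in>{\<tau> n \<omega>..<\<tau> (Suc n) \<omega>}. \<forall>k\<in>{1..N}.
      x k s \<omega> - x k (\<tau> n \<omega>) \<omega> = \<sigma> * (B k s \<omega> - B k (\<tau> n \<omega>) \<omega>)"
    and jumps: "AE \<omega> in M. \<forall>n\<ge>1. case p n \<omega> of (i, j) \<Rightarrow>
      ((\<lambda>s. x i s \<omega>) \<longlongrightarrow> x j (\<tau> n \<omega>) \<omega>) (at_left (\<tau> n \<omega>)) \<and>
      (\<forall>m\<in>{1..N} - {j}. ((\<lambda>s. x m s \<omega>) \<longlongrightarrow> x m (\<tau> n \<omega>) \<omega>) (at_left (\<tau> n \<omega>)))"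

end

theory Submission
  imports Defs "HOL-Real_Asymp.Real_Asymp"
begin

text \<open>
  The mean variance has a closed form. A uniformly chosen synchronizing jump multiplies the
  mean of \<open>V\<close> by \<open>\<rho> = 1 - 2 / (N (N - 1))\<close>, free motion during time \<open>s\<close> adds \<open>\<sigma>\<^sup>2 s\<close>, and the
  jumps occur at rate \<open>\<delta>\<close>, so with \<open>\<theta> = 2 \<delta> / (N (N - 1))\<close>
  \<open>R(t) = exp (- \<theta> t) R(0) + \<sigma>\<^sup>2 (1 - exp (- \<theta> t)) / \<theta>\<close>,
  and the three regimes are \<open>\<theta> t \<rightarrow> 0\<close>, \<open>\<theta> t \<rightarrow> c\<close> and \<open>\<theta> t \<rightarrow> \<infinity>\<close>.

  Instead of the Markov property of the process the proof uses mutual independence of the four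
  sources: on the event of exactly \<open>n\<close> jumps before \<open>t\<close> the configuration is an explicit function
  of epochs, initial state, pairs and Brownian paths, and each source may be evaluated at its own
  independent copy of \<open>\<omega>\<close>. For fixed epochs the mean of \<open>V\<close> then follows an affine recursion in the
  gaps. It is integrated over the exponential gaps by removing the last gap, and the results are
  summed over \<open>n\<close>; the probabilities of the events sum to 1, so explosion is excluded on the way.
\<close>

text \<open>The mean of V obeys a closed equation because V is built from two statistics, the sum of
  squares and the square of the sum: averaging over a uniform pair, or adding independent centered
  Gaussians, maps each of them to an affine function of the two, and V reproduces itself. The rate
  \<open>\<theta>\<close> is \<open>\<delta> * (1 - retention)\<close>. The obstacle is the event of
  exactly n jumps before t: it ties the gaps together through their sum, so their means cannot be
  inserted one at a time into the affine recursion. The exponential law helps: the density of a gap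
  x times exp(-delta (t - u - x)) is constant in x on 0 <= x <= t - u. Integrating out a gap is
  therefore a Beta integral, and the weights exp(-delta a) a^m in the age a = t - u form a class
  closed under this operation. All integrals take values in [0, infinity], so sums and integrals are
  exchanged on measurability alone, and finiteness of the mean variance at time t comes out as a
  result.\<close>

section \<open>Independence as evaluation at separate copies of the sample point\<close>

lemma (in prob_space) nn_integral_indep_var:
  assumes "indep_var S U T W" and f[measurable]: "f \<in> borel_measurable (S \<Otimes>\<^sub>M T)"
  shows "(\<integral>\<^sup>+\<omega>. f (U \<omega>, W \<omega>) \<partial>M) = (\<integral>\<^sup>+\<omega>. \<integral>\<^sup>+\<omega>'. f (U \<omega>, W \<omega>') \<partial>M \<partial>M)"
proof -
  have U[measurable]: "U \<in> measurable M S" and W[measurable]: "W \<in> measurable M T"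
    and eq: "distr M S U \<Otimes>\<^sub>M distr M T W = distr M (S \<Otimes>\<^sub>M T) (\<lambda>\<omega>. (U \<omega>, W \<omega>))"
    using assms(1) unfolding indep_var_distribution_eq by auto
  interpret W: prob_space "distr M T W" by (rule prob_space_distr) fact
  have "(\<integral>\<^sup>+\<omega>. f (U \<omega>, W \<omega>) \<partial>M) = (\<integral>\<^sup>+z. f z \<partial>(distr M S U \<Otimes>\<^sub>M distr M T W))"
    unfolding eq by (subst nn_integral_distr) auto
  also have "\<dots> = (\<integral>\<^sup>+u. \<integral>\<^sup>+w. f (u, w) \<partial>distr M T W \<partial>distr M S U)"
    by (rule W.nn_integral_fst[symmetric]) simp
  also have "\<dots> = (\<integral>\<^sup>+\<omega>. \<integral>\<^sup>+w. f (U \<omega>, w) \<partial>distr M T W \<partial>M)"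
    by (subst nn_integral_distr) (auto intro!: W.borel_measurable_nn_integral_fst)
  also have "\<dots> = (\<integral>\<^sup>+\<omega>. \<integral>\<^sup>+\<omega>'. f (U \<omega>, W \<omega>') \<partial>M \<partial>M)"
    by (intro nn_integral_cong, subst nn_integral_distr) (auto dest: measurable_space[OF U])
  finally show ?thesis .
qed

lemma (in prob_space) nn_integral_indep_vars_split:
  assumes "indep_vars V X I" "A \<subseteq> I" "C \<subseteq> I" "A \<inter> C = {}"
    and "f \<in> borel_measurable (PiM A V \<Otimes>\<^sub>M PiM C V)"
  shows "(\<integral>\<^sup>+\<omega>. f (\<lambda>i\<in>A. X i \<omega>, \<lambda>i\<in>C. X i \<omega>) \<partial>M) =
    (\<integral>\<^sup>+\<omega>. \<integral>\<^sup>+\<omega>'. f (\<lambda>i\<in>A. X i \<omega>, \<lambda>i\<in>C. X i \<omega>') \<partial>M \<partial>M)"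
  by (rule nn_integral_indep_var[OF indep_var_restrict[OF assms(1,4,2,3)] assms(5)])

lemma (in prob_space) nn_integral_indep_vars4:
  assumes ind: "indep_vars V X I"
    and I: "a \<in> I" "b \<in> I" "c \<in> I" "d \<in> I"
    and ne: "a \<noteq> b" "a \<noteq> c" "a \<noteq> d" "b \<noteq> c" "b \<noteq> d" "c \<noteq> d"
    and f[measurable]: "f \<in> borel_measurable (V a \<Otimes>\<^sub>M V b \<Otimes>\<^sub>M V c \<Otimes>\<^sub>M V d)"
  shows "(\<integral>\<^sup>+\<omega>. f (X a \<omega>, X b \<omega>, X c \<omega>, X d \<omega>) \<partial>M) =
    (\<integral>\<^sup>+\<omega>1. \<integral>\<^sup>+\<omega>2. \<integral>\<^sup>+\<omega>3. \<integral>\<^sup>+\<omega>4. f (X a \<omega>1, X b \<omega>2, X c \<omega>3, X d \<omega>4) \<partial>M \<partial>M \<partial>M \<partial>M)"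
proof -
  have X: "i \<in> I \<Longrightarrow> \<omega> \<in> space M \<Longrightarrow> X i \<omega> \<in> space (V i)" for i \<omega>
    using ind unfolding indep_vars_def by (auto dest: measurable_space)
  note split = nn_integral_indep_vars_split[OF ind]
  have "(\<integral>\<^sup>+\<omega>. f (X a \<omega>, X b \<omega>, X c \<omega>, X d \<omega>) \<partial>M) =
      (\<integral>\<^sup>+\<omega>1. \<integral>\<^sup>+\<omega>2. f (X a \<omega>1, X b \<omega>2, X c \<omega>2, X d \<omega>2) \<partial>M \<partial>M)"
    using split[of "{a}" "{b, c, d}" "\<lambda>(u, w). f (u a, w b, w c, w d)"] I ne by simp
  also have "\<dots> = (\<integral>\<^sup>+\<omega>1. \<integral>\<^sup>+\<omega>2. \<integral>\<^sup>+\<omega>3. f (X a \<omega>1, X b \<omega>2, X c \<omega>3, X d \<omega>3) \<partial>M \<partial>M \<partial>M)"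
  proof (rule nn_integral_cong)
    fix \<omega>1 assume [simp]: "\<omega>1 \<in> space M"
    show "(\<integral>\<^sup>+\<omega>2. f (X a \<omega>1, X b \<omega>2, X c \<omega>2, X d \<omega>2) \<partial>M) =
        (\<integral>\<^sup>+\<omega>2. \<integral>\<^sup>+\<omega>3. f (X a \<omega>1, X b \<omega>2, X c \<omega>3, X d \<omega>3) \<partial>M \<partial>M)"
      using split[of "{b}" "{c, d}" "\<lambda>(u, w). f (X a \<omega>1, u b, w c, w d)"] I ne X[of a \<omega>1] by simp
  qed
  also have "\<dots> = (\<integral>\<^sup>+\<omega>1. \<integral>\<^sup>+\<omega>2. \<integral>\<^sup>+\<omega>3. \<integral>\<^sup>+\<omega>4. f (X a \<omega>1, X b \<omega>2, X c \<omega>3, X d \<omega>4) \<partial>M \<partial>M \<partial>M \<partial>M)"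
  proof (rule nn_integral_cong, rule nn_integral_cong)
    fix \<omega>1 \<omega>2 assume [simp]: "\<omega>1 \<in> space M" "\<omega>2 \<in> space M"
    show "(\<integral>\<^sup>+\<omega>3. f (X a \<omega>1, X b \<omega>2, X c \<omega>3, X d \<omega>3) \<partial>M) =
        (\<integral>\<^sup>+\<omega>3. \<integral>\<^sup>+\<omega>4. f (X a \<omega>1, X b \<omega>2, X c \<omega>3, X d \<omega>4) \<partial>M \<partial>M)"
      using split[of "{c}" "{d}" "\<lambda>(u, w). f (X a \<omega>1, X b \<omega>2, u c, w d)"] I ne
        X[of a \<omega>1] X[of b \<omega>2] by simp
  qed
  finally show ?thesis .
qed

section \<open>Synchronization and the sample variance\<close>

lemma sample_variance_eq:
  assumes "N \<ge> 2"
  shows "sample_variance N y =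
    ((\<Sum>k=1..N. (y k)\<^sup>2) - (\<Sum>k=1..N. y k)\<^sup>2 / real N) / (real N - 1)"
proof -
  define L where "L = (\<Sum>k=1..N. y k)"
  have "(\<Sum>k=1..N. (y k - L / N)\<^sup>2) = (\<Sum>k=1..N. (y k)\<^sup>2 - (2 * L / N) * y k + (L / N)\<^sup>2)"
    by (intro sum.cong refl) (simp add: power2_eq_square algebra_simps)
  also have "\<dots> = (\<Sum>k=1..N. (y k)\<^sup>2) - (2 * L / N) * L + N * (L / N)\<^sup>2"
    by (simp add: sum.distrib sum_subtractf sum_distrib_left L_def sum_divide_distrib)
  also have "\<dots> = (\<Sum>k=1..N. (y k)\<^sup>2) - L\<^sup>2 / N"
    using assms by (simp add: power2_eq_square field_simps)
  finally show ?thesis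
    by (simp add: sample_variance_def center_of_mass_def L_def)
qed

lemma sample_variance_cong:
  "(\<And>k. k \<in> {1..N} \<Longrightarrow> y k = z k) \<Longrightarrow> sample_variance N y = sample_variance N z"
  by (simp add: sample_variance_def center_of_mass_def)

lemma sample_variance_nonneg: "N \<ge> 2 \<Longrightarrow> 0 \<le> sample_variance N y"
  by (simp add: sample_variance_def sum_nonneg)

fun synchronize :: "nat \<times> nat \<Rightarrow> (nat \<Rightarrow> 'a) \<Rightarrow> nat \<Rightarrow> 'a" where
  "synchronize (i, j) y = y(j := y i)"

text \<open>Over the full square of index pairs the double sums factor and give N^2 - 2 times V. The
  N diagonal pairs leave \<open>y\<close> unchanged and account for N times V, so the off-diagonal
  pairs carry N (N - 1) - 2.\<close>

lemma sum_sample_variance_synchronize: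
  assumes N: "N \<ge> 2"
  shows "(\<Sum>ij\<in>ordered_pairs N. sample_variance N (synchronize ij y)) =
    (real N * (real N - 1) - 2) * sample_variance N y"
proof -
  let ?V = "sample_variance N" and ?I = "{1..N}"
  define Q L where "Q = (\<Sum>k\<in>?I. (y k)\<^sup>2)" and "L = (\<Sum>k\<in>?I. y k)"
  have QL: "(\<Sum>k = Suc 0..N. (y k)\<^sup>2) = Q" "sum y {Suc 0..N} = L"
    by (simp_all add: Q_def L_def)
  have V: "?V y = (Q - L\<^sup>2 / N) / (real N - 1)"
    unfolding Q_def L_def by (rule sample_variance_eq[OF N])
  have *: "?V (synchronize (i, j) y) =
      ((Q - (y j)\<^sup>2 + (y i)\<^sup>2) - (L - y j + y i)\<^sup>2 / N) / (real N - 1)"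
    if "i \<in> ?I" "j \<in> ?I" for i j
  proof -
    have "(\<Sum>k\<in>?I. ((y(j := y i)) k)\<^sup>2) = Q - (y j)\<^sup>2 + (y i)\<^sup>2"
      using that(2) by (subst sum.remove[of _ j]) (simp_all add: Q_def sum_diff1)
    moreover have "(\<Sum>k\<in>?I. (y(j := y i)) k) = L - y j + y i"
      using that(2) by (subst sum.remove[of _ j]) (simp_all add: L_def sum_diff1)
    ultimately show ?thesis by (simp add: sample_variance_eq[OF N] del: fun_upd_apply)
  qed
  have 1: "(\<Sum>i\<in>?I. \<Sum>j\<in>?I. Q - (y j)\<^sup>2 + (y i)\<^sup>2) = N\<^sup>2 * Q"
    by (simp add: sum.distrib sum_subtractf QL flip: sum_distrib_left)
       (simp add: power2_eq_square algebra_simps)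
  have "(\<Sum>i\<in>?I. \<Sum>j\<in>?I. (L - y j + y i)\<^sup>2) =
      (\<Sum>i\<in>?I. \<Sum>j\<in>?I. (L\<^sup>2 + 2 * L * y i + (y i)\<^sup>2) - (2 * L + 2 * y i) * y j + (y j)\<^sup>2)"
    by (intro sum.cong refl) (simp add: power2_eq_square algebra_simps)
  also have "\<dots> = (\<Sum>i\<in>?I. N * (L\<^sup>2 + 2 * L * y i + (y i)\<^sup>2) - (2 * L + 2 * y i) * L + Q)"
    by (simp add: sum.distrib sum_subtractf QL flip: sum_distrib_left)
  also have "\<dots> = N * (N * L\<^sup>2 + 2 * L * L + Q) - (2 * L * N + 2 * L) * L + N * Q"
    by (simp add: sum.distrib sum_subtractf QL
      flip: sum_distrib_left sum_distrib_right)
  finally have 2: "(\<Sum>i\<in>?I. \<Sum>j\<in>?I. (L - y j + y i)\<^sup>2) = N\<^sup>2 * L\<^sup>2 + 2 * N * Q - 2 * L\<^sup>2"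
    by (simp add: power2_eq_square algebra_simps)
  have "(\<Sum>i\<in>?I. \<Sum>j\<in>?I. ?V (synchronize (i, j) y)) =
      ((\<Sum>i\<in>?I. \<Sum>j\<in>?I. Q - (y j)\<^sup>2 + (y i)\<^sup>2)
        - (\<Sum>i\<in>?I. \<Sum>j\<in>?I. (L - y j + y i)\<^sup>2) / N) / (real N - 1)"
    by (simp add: * sum_subtractf sum_divide_distrib diff_divide_distrib del: synchronize.simps)
  also have "\<dots> = ((real N)\<^sup>2 - 2) * ?V y"
    unfolding 1 2 V using N by (simp add: field_simps power2_eq_square)
  finally have total: "(\<Sum>ij\<in>?I \<times> ?I. ?V (synchronize ij y)) = ((real N)\<^sup>2 - 2) * ?V y"
    by (simp add: sum.cartesian_product case_prod_unfold del: synchronize.simps)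
  have "?I \<times> ?I = ordered_pairs N \<union> (\<lambda>i. (i, i)) ` ?I"
    and "ordered_pairs N \<inter> (\<lambda>i. (i, i)) ` ?I = {}"
    by (auto simp: ordered_pairs_def)
  moreover have "finite (ordered_pairs N)"
    by (rule finite_subset[of _ "?I \<times> ?I"]) (auto simp: ordered_pairs_def)
  ultimately have "(\<Sum>ij\<in>?I \<times> ?I. ?V (synchronize ij y)) =
      (\<Sum>ij\<in>ordered_pairs N. ?V (synchronize ij y)) +
      (\<Sum>ij\<in>(\<lambda>i. (i, i)) ` ?I. ?V (synchronize ij y))"
    by (simp add: sum.union_disjoint)
  also have "(\<Sum>ij\<in>(\<lambda>i. (i, i)) ` ?I. ?V (synchronize ij y)) = N * ?V y"
    by (subst sum.reindex) (auto simp: inj_on_def)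
  finally show ?thesis using total by (simp add: power2_eq_square algebra_simps)
qed

lemma ordered_pairs_facts:
  assumes "N \<ge> 2"
  shows finite_ordered_pairs: "finite (ordered_pairs N)"
    and card_ordered_pairs: "real (card (ordered_pairs N)) = real N * (real N - 1)"
    and ordered_pairs_nonempty: "ordered_pairs N \<noteq> {}"
proof -
  have eq: "ordered_pairs N = {1..N} \<times> {1..N} - (\<lambda>i. (i, i)) ` {1..N}"
    by (auto simp: ordered_pairs_def)
  show "finite (ordered_pairs N)" unfolding eq by simp
  have "card (ordered_pairs N) = N * N - N"
    unfolding eq by (subst card_Diff_subset) (auto simp: card_image inj_on_def)
  then show "real (card (ordered_pairs N)) = real N * (real N - 1)"
    by (simp add: of_nat_diff algebra_simps)
  have "(1, 2) \<in> ordered_pairs N" using assms by (auto simp: ordered_pairs_def)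
  then show "ordered_pairs N \<noteq> {}" by blast
qed

section \<open>Exponential gaps\<close>

text \<open>
  For gaps \<open>g\<close> between the epochs, \<open>r = \<rho>\<close>, \<open>c = \<sigma>\<^sup>2\<close> and \<open>v = R(0)\<close> this is the mean of \<open>V\<close> just
  after the \<open>n\<close>-th jump; \<open>g 0\<close> is ignored.
\<close>

primrec accumulated :: "real \<Rightarrow> real \<Rightarrow> real \<Rightarrow> (nat \<Rightarrow> real) \<Rightarrow> nat \<Rightarrow> real" where
  "accumulated r c v g 0 = v"
| "accumulated r c v g (Suc n) = r * (accumulated r c v g n + c * g (Suc n))"

lemma accumulated_cong:
  "(\<And>i. i \<in> {1..n} \<Longrightarrow> g i = h i) \<Longrightarrow> accumulated r c v g n = accumulated r c v h n"
  by (induction n) auto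

text \<open>With the parameters 1, 0, 1 the formulas for the mean of V become formulas for the
  probability of exactly n jumps, so both are obtained from the same computation.\<close>

lemma accumulated_const: "accumulated 1 0 1 g n = 1"
  by (induction n) auto

lemma accumulated_nonneg:
  "r \<ge> 0 \<Longrightarrow> c \<ge> 0 \<Longrightarrow> v \<ge> 0 \<Longrightarrow> (\<And>i. i \<in> {1..n} \<Longrightarrow> 0 \<le> g i) \<Longrightarrow> 0 \<le> accumulated r c v g n"
  by (induction n) auto

lemma accumulated_measurable [measurable (raw)]:
  assumes "\<And>i. i \<in> {1..n} \<Longrightarrow> (\<lambda>z. g z i) \<in> borel_measurable S"
  shows "(\<lambda>z. accumulated r c v (g z) n) \<in> borel_measurable S"
  using assms
proof (induction n)
  case (Suc n)
  have [measurable]: "(\<lambda>z. accumulated r c v (g z) n) \<in> borel_measurable S"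
    "(\<lambda>z. g z (Suc n)) \<in> borel_measurable S"
    using Suc by auto
  show ?case by simp
qed simp

locale poisson_gaps = prob_space M for M :: "'a measure" +
  fixes \<xi> :: "nat \<Rightarrow> 'a \<Rightarrow> real" and \<delta> :: real
  assumes \<delta>_pos: "\<delta> > 0"
    and gaps_indep: "indep_vars (\<lambda>_. borel) \<xi> {1..}"
    and gaps_exponential: "\<And>n. n \<ge> 1 \<Longrightarrow> distributed M lborel (\<xi> n) (exponential_density \<delta>)"
begin

definition epoch :: "nat \<Rightarrow> 'a \<Rightarrow> real" where
  "epoch n \<omega> = (\<Sum>i\<in>{1..n}. \<xi> i \<omega>)"

text \<open>
  Integrating out the last gap raises the power of the age \<open>t - u\<close>, so the induction on the number
  of epochs has to treat all powers \<open>m\<close> at once.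
\<close>

definition age_weight :: "nat \<Rightarrow> real \<Rightarrow> real \<Rightarrow> real" where
  "age_weight m t u = (if u \<le> t then exp (- (\<delta> * (t - u))) * (t - u) ^ m else 0)"

lemma gap_measurable [measurable]: "n \<ge> 1 \<Longrightarrow> \<xi> n \<in> borel_measurable M"
  using gaps_indep by (auto simp: indep_vars_def)

lemma age_weight_measurable [measurable]: "age_weight m t \<in> borel_measurable borel"
  unfolding age_weight_def by measurable

lemma age_weight_nonneg: "age_weight m t u \<ge> 0"
  by (simp add: age_weight_def)

lemma gaps_nonneg: "AE \<omega> in M. \<forall>i\<ge>1. 0 \<le> \<xi> i \<omega>"
proof -
  have "AE \<omega> in M. 0 \<le> \<xi> i \<omega>" if "i \<ge> 1" for i
    using gaps_exponential[OF that]
    by (subst distributed_AE2[OF gaps_exponential[OF that]])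
       (auto simp: exponential_density_def)
  then show ?thesis by (simp add: AE_all_countable)
qed

text \<open>Here \<open>u\<close> is the previous epoch and \<open>a\<close> the value accumulated
  there. The two exponentials multiply to exp(-delta (t - u)), and what remains are the integrals of
  (R - x)^m and x (R - x)^m over [0, R] with R = t - u, namely R^(m+1) / (m+1) and R^(m+2) / ((m+1)
  (m+2)).\<close>

lemma nn_integral_gap_step:
  assumes "r \<ge> 0" "c \<ge> 0" "a \<ge> 0" "n \<ge> 1"
  shows "(\<integral>\<^sup>+\<omega>. ennreal (age_weight m t (u + \<xi> n \<omega>) * (r * (a + c * \<xi> n \<omega>))) \<partial>M) =
    ennreal (r * \<delta> / (m + 1) * (age_weight (m + 1) t u * a)
      + r * \<delta> * c / ((m + 1) * (m + 2)) * age_weight (m + 2) t u)"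
proof -
  let ?f = "\<lambda>x. ennreal (age_weight m t (u + x) * (r * (a + c * x)))"
  define R where "R = t - u"
  have "(\<integral>\<^sup>+\<omega>. ?f (\<xi> n \<omega>) \<partial>M) = (\<integral>\<^sup>+x. ennreal (exponential_density \<delta> x) * ?f x \<partial>lborel)"
    by (rule distributed_nn_integral[OF gaps_exponential[OF assms(4)], symmetric]) simp
  also have "\<dots> = ennreal (r * \<delta> / (m + 1) * (age_weight (m + 1) t u * a)
      + r * \<delta> * c / ((m + 1) * (m + 2)) * age_weight (m + 2) t u)"
  proof (cases "u \<le> t")
    case False
    then have "(\<integral>\<^sup>+x. ennreal (exponential_density \<delta> x) * ?f x \<partial>lborel) = (\<integral>\<^sup>+(x::real). 0 \<partial>lborel)"
      by (intro nn_integral_cong) (auto simp: exponential_density_def age_weight_def)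
    with False show ?thesis by (simp add: age_weight_def)
  next
    case True
    then have R: "R \<ge> 0" by (simp add: R_def)
    define k where "k = r * \<delta> * exp (- (\<delta> * R))"
    have k: "k \<ge> 0" using assms \<delta>_pos by (simp add: k_def)
    \<comment> \<open>An antiderivative, obtained by one integration by parts for x (R - x)^m. Every
      term carries a positive power of R - x, so F R = 0 and only F 0 survives.\<close>
    define F where "F x = - (k * (a * ((R - x) ^ (m + 1) / (m + 1))
      + c * (x * (R - x) ^ (m + 1) / (m + 1) + (R - x) ^ (m + 2) / ((m + 1) * (m + 2)))))" for x
    have "(\<integral>\<^sup>+x. ennreal (exponential_density \<delta> x) * ?f x \<partial>lborel) =
        (\<integral>\<^sup>+x. ennreal (k * ((R - x) ^ m * (a + c * x))) * indicator {0..R} x \<partial>lborel)"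
    proof (intro nn_integral_cong)
      fix x :: real
      have gen: "a * b = c \<Longrightarrow> d * a * (b * p * q) = d * c * p * q" for a b c d p q :: real
        by auto
      have "exp (- (\<delta> * x)) * exp (- (\<delta> * (t - (u + x)))) = exp (- (\<delta> * R))"
        by (simp add: R_def flip: exp_add) (simp add: algebra_simps)
      then have "\<delta> * exp (- x * \<delta>) * (exp (- (\<delta> * (t - (u + x)))) * (t - (u + x)) ^ m * (r * (a + c * x)))
          = \<delta> * exp (- (\<delta> * R)) * (t - (u + x)) ^ m * (r * (a + c * x))"
        using gen[of "exp (- (\<delta> * x))" _ _ \<delta>] by (simp only: mult_minus_left mult.commute[of x])
      also have "\<dots> = k * ((R - x) ^ m * (a + c * x))"
        by (simp add: k_def R_def diff_diff_eq)
      finally have eq: "\<delta> * exp (- x * \<delta>) * (exp (- (\<delta> * (t - (u + x)))) * (t - (u + x)) ^ m * (r * (a + c * x)))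
          = k * ((R - x) ^ m * (a + c * x))" .
      show "ennreal (exponential_density \<delta> x) * ?f x =
          ennreal (k * ((R - x) ^ m * (a + c * x))) * indicator {0..R} x"
      proof (cases "0 \<le> x \<and> x \<le> R")
        case True
        then have "ennreal (exponential_density \<delta> x) * ?f x = ennreal (\<delta> * exp (- x * \<delta>) *
            (exp (- (\<delta> * (t - (u + x)))) * (t - (u + x)) ^ m * (r * (a + c * x))))"
          using \<delta>_pos by (subst ennreal_mult') (auto simp: exponential_density_def age_weight_def R_def)
        with True show ?thesis unfolding eq by simp
      qed (auto simp: exponential_density_def age_weight_def R_def indicator_def)
    qed
    also have "\<dots> = F R - F 0"
    proof (rule nn_integral_FTC_Icc)
      fix x assume x: "x \<in> {0..R}"
      \<comment> \<open>Normalised so that \<open>P j\<close> has derivative - (R - x)^j for every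
        j; the derivative of \<open>F\<close> is then a bare product rule.\<close>
      define P where "P j x = (R - x) ^ Suc j / real (Suc j)" for j x
      have 1: "(P j has_real_derivative - ((R - x) ^ j)) (at x)" for j
        unfolding P_def by (rule derivative_eq_intros refl | simp del: power_Suc)+
      have eq: "F = (\<lambda>x. - (k * (a * P m x + c * (x * P m x + P (Suc m) x / (m + 1)))))"
        by (simp add: F_def P_def fun_eq_iff field_simps)
      show "(F has_real_derivative k * ((R - x) ^ m * (a + c * x))) (at x)"
      proof -
        have "P m x = - ((- ((R - x) ^ Suc m)) / (m + 1))" by (simp add: P_def)
        then have "k * ((R - x) ^ m * (a + c * x)) = - (k * (a * (- ((R - x) ^ m)) + c *
            (1 * P m x + (- ((R - x) ^ m)) * x + (- ((R - x) ^ Suc m)) / (m + 1))))"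
          by (simp del: power_Suc) (simp add: algebra_simps del: power_Suc)
        then show ?thesis
          unfolding eq
          by (simp only:) (intro DERIV_minus DERIV_cmult DERIV_add DERIV_mult DERIV_cdivide DERIV_ident 1)
      qed
      show "0 \<le> k * ((R - x) ^ m * (a + c * x))" using x assms k by simp
    qed (use R in auto)
    also have "F R - F 0 = k * (a * (R ^ (m + 1) / (m + 1)) + c * (R ^ (m + 2) / ((m + 1) * (m + 2))))"
      by (simp add: F_def)
    also have "\<dots> = r * \<delta> / (m + 1) * (age_weight (m + 1) t u * a)
      + r * \<delta> * c / ((m + 1) * (m + 2)) * age_weight (m + 2) t u"
    proof -
      have "age_weight j t u = exp (- (\<delta> * R)) * R ^ j" for j
        using True by (simp add: age_weight_def R_def)
      then show ?thesis by (simp add: k_def distrib_left mult_ac del: power_Suc)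
    qed
    finally show ?thesis .
  qed
  finally show ?thesis .
qed

text \<open>Independence speaks about families restricted to \<open>{1..n}\<close>. The second
  hypothesis, that \<open>f\<close> reads only these indices, allows the unrestricted gaps to be
  written instead.\<close>

lemma nn_integral_epoch_split:
  assumes [measurable]: "case_prod f \<in> borel_measurable (PiM {1..n} (\<lambda>_. borel) \<Otimes>\<^sub>M borel)"
  assumes f: "\<And>g h w. (\<And>i. i \<in> {1..n} \<Longrightarrow> g i = h i) \<Longrightarrow> f g w = f h w"
  shows "(\<integral>\<^sup>+\<omega>. f (\<lambda>i. \<xi> i \<omega>) (\<xi> (Suc n) \<omega>) \<partial>M) =
    (\<integral>\<^sup>+\<omega>. \<integral>\<^sup>+\<omega>'. f (\<lambda>i. \<xi> i \<omega>) (\<xi> (Suc n) \<omega>') \<partial>M \<partial>M)"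
proof -
  have "f (\<lambda>i\<in>{1..n}. \<xi> i \<omega>) w = f (\<lambda>i. \<xi> i \<omega>) w" for \<omega> w
    by (rule f) simp
  moreover have "(\<lambda>(u, w). f u (w (Suc n))) \<in> borel_measurable
      (PiM {1..n} (\<lambda>_. borel) \<Otimes>\<^sub>M PiM {Suc n} (\<lambda>_. borel))"
    by measurable
  ultimately show ?thesis
    using nn_integral_indep_vars_split[OF gaps_indep, of "{1..n}" "{Suc n}" "\<lambda>(u, w). f u (w (Suc n))"]
    by auto
qed

text \<open>The first summand stems from the state before the last gap, the second from the last gap
  itself. The latter no longer involves the accumulated value, and its constant factor 1 is written
  as \<open>accumulated 1 0 1\<close> so that it is again a weighted moment.\<close>

lemma weighted_moment_Suc:
  assumes "r \<ge> 0" "c \<ge> 0" "v \<ge> 0"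
  shows "(\<integral>\<^sup>+\<omega>. ennreal (age_weight m t (epoch (Suc n) \<omega>) * accumulated r c v (\<lambda>i. \<xi> i \<omega>) (Suc n)) \<partial>M) =
    ennreal (r * \<delta> / (m + 1)) *
      (\<integral>\<^sup>+\<omega>. ennreal (age_weight (m + 1) t (epoch n \<omega>) * accumulated r c v (\<lambda>i. \<xi> i \<omega>) n) \<partial>M)
    + ennreal (r * \<delta> * c / ((m + 1) * (m + 2))) *
      (\<integral>\<^sup>+\<omega>. ennreal (age_weight (m + 2) t (epoch n \<omega>) * accumulated 1 0 1 (\<lambda>i. \<xi> i \<omega>) n) \<partial>M)"
proof -
  let ?f = "\<lambda>g w. ennreal (age_weight m t ((\<Sum>i\<in>{1..n}. g i) + w) * (r * (accumulated r c v g n + c * w)))"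
  have [measurable]: "case_prod ?f \<in> borel_measurable (PiM {1..n} (\<lambda>_. borel) \<Otimes>\<^sub>M borel)"
    unfolding case_prod_beta by measurable
  have [measurable]: "epoch n \<in> borel_measurable M" unfolding epoch_def[abs_def] by measurable
  have "(\<integral>\<^sup>+\<omega>. ennreal (age_weight m t (epoch (Suc n) \<omega>) * accumulated r c v (\<lambda>i. \<xi> i \<omega>) (Suc n)) \<partial>M)
      = (\<integral>\<^sup>+\<omega>. ?f (\<lambda>i. \<xi> i \<omega>) (\<xi> (Suc n) \<omega>) \<partial>M)"
    by (simp add: epoch_def)
  also have "\<dots> = (\<integral>\<^sup>+\<omega>. \<integral>\<^sup>+\<omega>'. ?f (\<lambda>i. \<xi> i \<omega>) (\<xi> (Suc n) \<omega>') \<partial>M \<partial>M)"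
  proof (rule nn_integral_epoch_split)
    fix g h :: "nat \<Rightarrow> real" and w assume "\<And>i. i \<in> {1..n} \<Longrightarrow> g i = h i"
    then show "?f g w = ?f h w"
      using accumulated_cong[of n g h r c v] sum.cong[of "{1..n}" "{1..n}" g h] by simp
  qed fact
  also have "\<dots> = (\<integral>\<^sup>+\<omega>. ennreal (r * \<delta> / (m + 1)) * ennreal (age_weight (m + 1) t (epoch n \<omega>) * accumulated r c v (\<lambda>i. \<xi> i \<omega>) n)
      + ennreal (r * \<delta> * c / ((m + 1) * (m + 2))) * ennreal (age_weight (m + 2) t (epoch n \<omega>) * accumulated 1 0 1 (\<lambda>i. \<xi> i \<omega>) n) \<partial>M)"
  proof (rule nn_integral_cong_AE, use gaps_nonneg in eventually_elim)
    case (elim \<omega>)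
    have a: "0 \<le> accumulated r c v (\<lambda>i. \<xi> i \<omega>) n"
      by (rule accumulated_nonneg) (use assms elim in auto)
    have "(\<integral>\<^sup>+\<omega>'. ?f (\<lambda>i. \<xi> i \<omega>) (\<xi> (Suc n) \<omega>') \<partial>M) =
        ennreal (r * \<delta> / (m + 1) * (age_weight (m + 1) t (epoch n \<omega>) * accumulated r c v (\<lambda>i. \<xi> i \<omega>) n)
      + r * \<delta> * c / ((m + 1) * (m + 2)) * age_weight (m + 2) t (epoch n \<omega>))"
      using nn_integral_gap_step[OF assms(1,2) a, of "Suc n" m t "epoch n \<omega>"] by (simp add: epoch_def)
    also have "\<dots> = ennreal (r * \<delta> / (m + 1)) * ennreal (age_weight (m + 1) t (epoch n \<omega>) * accumulated r c v (\<lambda>i. \<xi> i \<omega>) n)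
      + ennreal (r * \<delta> * c / ((m + 1) * (m + 2))) * ennreal (age_weight (m + 2) t (epoch n \<omega>))"
      using assms \<delta>_pos a age_weight_nonneg[of _ t "epoch n \<omega>"]
      by (subst ennreal_plus) (auto intro!: mult_nonneg_nonneg divide_nonneg_nonneg simp flip: ennreal_mult)
    finally show ?case by (simp only: accumulated_const mult_1_right)
  qed
  also have "\<dots> = ennreal (r * \<delta> / (m + 1)) *
      (\<integral>\<^sup>+\<omega>. ennreal (age_weight (m + 1) t (epoch n \<omega>) * accumulated r c v (\<lambda>i. \<xi> i \<omega>) n) \<partial>M)
    + ennreal (r * \<delta> * c / ((m + 1) * (m + 2))) *
      (\<integral>\<^sup>+\<omega>. ennreal (age_weight (m + 2) t (epoch n \<omega>) * accumulated 1 0 1 (\<lambda>i. \<xi> i \<omega>) n) \<partial>M)"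
    by (subst nn_integral_add, simp_all add: nn_integral_cmult)
  finally show ?thesis .
qed

text \<open>Solved before the general case because for \<open>c = 0\<close> the recursion involves
  no second family of moments. Each gap raises the power of the age by one and divides by
  it.\<close>

lemma weighted_count_moment:
  assumes "t \<ge> 0"
  shows "(\<integral>\<^sup>+\<omega>. ennreal (age_weight m t (epoch n \<omega>) * accumulated 1 0 1 (\<lambda>i. \<xi> i \<omega>) n) \<partial>M) =
    ennreal (exp (- (\<delta> * t)) * \<delta> ^ n * fact m * t ^ (n + m) / fact (n + m))"
proof (induction n arbitrary: m)
  case 0
  show ?case using assms by (simp add: age_weight_def epoch_def emeasure_space_1)
next
  case (Suc n)
  have "\<delta> / real (m + 1) * (exp (- (\<delta> * t)) * \<delta> ^ n * fact (m + 1) * t ^ (n + (m + 1)) / fact (n + (m + 1))) =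
      exp (- (\<delta> * t)) * \<delta> ^ Suc n * fact m * t ^ (Suc n + m) / fact (Suc n + m)"
  proof -
    have "(fact (m + 1) :: real) = real (m + 1) * fact m" by simp
    then show ?thesis by (simp del: fact_Suc of_nat_Suc of_nat_add)
  qed
  then show ?case
    using assms \<delta>_pos
    by (subst weighted_moment_Suc) (simp_all add: Suc.IH del: accumulated.simps fact_Suc power_Suc flip: ennreal_mult)
qed

text \<open>Unfolded, the accumulated value is r^n v plus c times the sum of r^(n-i+1) times gap i,
  since gap i is damped by the jumps i to n. Under the weight all gaps have the same moment, which
  explains the common factor in front of the geometric sum.\<close>

lemma weighted_moment:
  assumes "r \<ge> 0" "c \<ge> 0" "v \<ge> 0" "t \<ge> 0"
  shows "(\<integral>\<^sup>+\<omega>. ennreal (age_weight m t (epoch n \<omega>) * accumulated r c v (\<lambda>i. \<xi> i \<omega>) n) \<partial>M) =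
    ennreal (exp (- (\<delta> * t)) * \<delta> ^ n * fact m *
      (r ^ n * v * t ^ (n + m) / fact (n + m)
       + c * t ^ (n + m + 1) / fact (n + m + 1) * (\<Sum>i\<in>{1..n}. r ^ i)))"
proof (induction n arbitrary: m)
  case 0
  show ?case using assms by (simp add: age_weight_def epoch_def emeasure_space_1)
next
  case (Suc n)
  define P where "P = (\<Sum>i\<in>{1..n}. r ^ i)"
  have P: "P \<ge> 0" using assms by (auto simp: P_def intro!: sum_nonneg)
  have "(\<Sum>i\<in>{1..Suc n}. r ^ i) = (\<Sum>i\<in>Suc ` {0..n}. r ^ i)"
    by (simp only: image_Suc_atLeastAtMost One_nat_def)
  also have "\<dots> = r * (\<Sum>i\<in>{0..n}. r ^ i)"
    by (subst sum.reindex) (simp_all add: sum_distrib_left)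
  also have "(\<Sum>i\<in>{0..n}. r ^ i) = 1 + P"
    by (simp add: P_def sum.atLeast_Suc_atMost)
  finally have S: "(\<Sum>i\<in>{1..Suc n}. r ^ i) = r * (1 + P)" .
  have alg: "r * \<delta> / real (m + 1) * (exp (- (\<delta> * t)) * \<delta> ^ n * fact (m + 1) *
        (r ^ n * v * t ^ (n + (m + 1)) / fact (n + (m + 1)) + c * t ^ (n + (m + 1) + 1) / fact (n + (m + 1) + 1) * P))
      + r * \<delta> * c / real ((m + 1) * (m + 2)) *
        (exp (- (\<delta> * t)) * \<delta> ^ n * fact (m + 2) * t ^ (n + (m + 2)) / fact (n + (m + 2)))
      = exp (- (\<delta> * t)) * \<delta> ^ Suc n * fact m *
        (r ^ Suc n * v * t ^ (Suc n + m) / fact (Suc n + m) + c * t ^ (Suc n + m + 1) / fact (Suc n + m + 1) * (r * (1 + P)))"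
  proof -
    \<comment> \<open>Powers, factorials and the exponential are replaced by free variables, so that
      the identity is one between rational functions and the simplifier cannot unfold the
      factorials.\<close>
    have gen: "r * \<delta> / a * (E * dn * (a * f) * (rn * v * x1 / D1 + c * x2 / D2 * P))
        + r * \<delta> * c / (a * b) * (E * dn * (b * (a * f)) * x2 / D2)
      = E * (\<delta> * dn) * f * (r * rn * v * x1 / D1 + c * x2 / D2 * (r * (1 + P)))"
      if "a \<noteq> 0" "b \<noteq> 0" "D1 \<noteq> 0" "D2 \<noteq> 0" for a b f E dn rn x1 x2 D1 D2 :: real
      using that by (simp add: divide_simps) (simp add: algebra_simps)
    have f: "(fact (m + 1) :: real) = real (m + 1) * fact m"
      "(fact (m + 2) :: real) = real (m + 2) * (real (m + 1) * fact m)"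
      by (simp_all add: numeral_2_eq_2)
    have e: "n + (m + 1) = Suc (n + m)" "Suc (n + m) + 1 = Suc (Suc (n + m))"
      "n + (m + 2) = Suc (Suc (n + m))" "Suc n + m = Suc (n + m)"
      by simp_all
    show ?thesis
      unfolding f e of_nat_mult power_Suc[of \<delta> n] power_Suc[of r n]
      by (rule gen) (simp_all del: fact_Suc)
  qed
  show ?case
    apply (subst weighted_moment_Suc)
       apply (simp_all only: assms)[3]
    apply (subst Suc.IH, subst weighted_count_moment)
     apply (simp only: assms)
    unfolding S P_def[symmetric]
    apply (subst ennreal_mult[symmetric], use assms \<delta>_pos P in simp, use assms \<delta>_pos P in simp)
    apply (subst ennreal_mult[symmetric], use assms \<delta>_pos P in simp, use assms \<delta>_pos P in simp)
    apply (subst ennreal_plus[symmetric], use assms \<delta>_pos P in simp, use assms \<delta>_pos P in simp)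
    apply (rule arg_cong[of _ _ ennreal])
    apply (rule alg)
    done
qed

text \<open>Given the first n gaps with sum u <= t, the next gap exceeds t - u with probability
  exp(-delta (t - u)). This is the age weight with power 0; the factor t - u from the unfinished
  free motion gives power 1.\<close>

lemma nn_integral_between_epochs:
  assumes "r \<ge> 0" "c \<ge> 0" "v \<ge> 0" "t \<ge> 0"
  shows "(\<integral>\<^sup>+\<omega>. indicator {\<omega>. epoch n \<omega> \<le> t \<and> t < epoch (Suc n) \<omega>} \<omega> *
      ennreal (accumulated r c v (\<lambda>i. \<xi> i \<omega>) n + c * (t - epoch n \<omega>)) \<partial>M) =
    ennreal (exp (- (\<delta> * t)) * ((\<delta> * r * t) ^ n / fact n * v
       + c * \<delta> ^ n * t ^ Suc n / fact (Suc n) * (\<Sum>i\<le>n. r ^ i)))"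
proof -
  let ?f = "\<lambda>g w. indicator {w. (\<Sum>i\<in>{1..n}. g i) \<le> t \<and> t < (\<Sum>i\<in>{1..n}. g i) + w} w *
      ennreal (accumulated r c v g n + c * (t - (\<Sum>i\<in>{1..n}. g i)))"
  have [measurable]: "case_prod ?f \<in> borel_measurable (PiM {1..n} (\<lambda>_. borel) \<Otimes>\<^sub>M borel)"
    unfolding case_prod_beta indicator_def mem_Collect_eq by measurable
  have [measurable]: "epoch n \<in> borel_measurable M" unfolding epoch_def[abs_def] by measurable
  have "(\<integral>\<^sup>+\<omega>. indicator {\<omega>. epoch n \<omega> \<le> t \<and> t < epoch (Suc n) \<omega>} \<omega> *
      ennreal (accumulated r c v (\<lambda>i. \<xi> i \<omega>) n + c * (t - epoch n \<omega>)) \<partial>M)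
      = (\<integral>\<^sup>+\<omega>. ?f (\<lambda>i. \<xi> i \<omega>) (\<xi> (Suc n) \<omega>) \<partial>M)"
    by (simp add: epoch_def indicator_def)
  also have "\<dots> = (\<integral>\<^sup>+\<omega>. \<integral>\<^sup>+\<omega>'. ?f (\<lambda>i. \<xi> i \<omega>) (\<xi> (Suc n) \<omega>') \<partial>M \<partial>M)"
  proof (rule nn_integral_epoch_split)
    fix g h :: "nat \<Rightarrow> real" and w assume "\<And>i. i \<in> {1..n} \<Longrightarrow> g i = h i"
    then show "?f g w = ?f h w"
      using accumulated_cong[of n g h r c v] sum.cong[of "{1..n}" "{1..n}" g h] by simp
  qed fact
  also have "\<dots> = (\<integral>\<^sup>+\<omega>. ennreal (age_weight 0 t (epoch n \<omega>) * accumulated r c v (\<lambda>i. \<xi> i \<omega>) n)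
      + ennreal c * ennreal (age_weight 1 t (epoch n \<omega>) * accumulated 1 0 1 (\<lambda>i. \<xi> i \<omega>) n) \<partial>M)"
  proof (rule nn_integral_cong_AE, use gaps_nonneg in eventually_elim)
    case (elim \<omega>)
    have a: "0 \<le> accumulated r c v (\<lambda>i. \<xi> i \<omega>) n"
      by (rule accumulated_nonneg) (use assms elim in auto)
    define u where "u = epoch n \<omega>"
    have u: "(\<Sum>i\<in>{1..n}. \<xi> i \<omega>) = u" by (simp add: u_def epoch_def)
    show ?case
    proof (cases "u \<le> t")
      case True
      have "(\<integral>\<^sup>+\<omega>'. ?f (\<lambda>i. \<xi> i \<omega>) (\<xi> (Suc n) \<omega>') \<partial>M) =
          (\<integral>\<^sup>+\<omega>'. ennreal (accumulated r c v (\<lambda>i. \<xi> i \<omega>) n + c * (t - u)) *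
            indicator {\<omega> \<in> space M. t - u < \<xi> (Suc n) \<omega>} \<omega>' \<partial>M)"
        using True unfolding u by (intro nn_integral_cong) (auto simp: indicator_def)
      also have "\<dots> = ennreal (accumulated r c v (\<lambda>i. \<xi> i \<omega>) n + c * (t - u)) *
          emeasure M {\<omega> \<in> space M. t - u < \<xi> (Suc n) \<omega>}"
        by (rule nn_integral_cmult_indicator) measurable
      also have "emeasure M {\<omega> \<in> space M. t - u < \<xi> (Suc n) \<omega>} = ennreal (exp (- (t - u) * \<delta>))"
        using exponential_distributedD_gt[OF gaps_exponential[of "Suc n"], of "t - u"] True \<delta>_pos
        by (simp add: emeasure_eq_measure)
      also have "ennreal (A + c * d) * ennreal (exp (- d * \<delta>)) =
          ennreal (exp (- (\<delta> * d)) * A) + ennreal c * ennreal (exp (- (\<delta> * d)) * d)"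
        if "A \<ge> 0" "d \<ge> 0" for A d
        using that assms by (simp add: algebra_simps flip: ennreal_mult ennreal_plus)
      finally show ?thesis
        using True a by (simp add: age_weight_def accumulated_const flip: u_def)
    next
      case False
      then show ?thesis unfolding u by (simp add: age_weight_def flip: u_def)
    qed
  qed
  also have "\<dots> = ennreal (exp (- (\<delta> * t)) * \<delta> ^ n *
      (r ^ n * v * t ^ n / fact n + c * t ^ Suc n / fact (Suc n) * (\<Sum>i\<in>{1..n}. r ^ i)))
      + ennreal (c * (exp (- (\<delta> * t)) * \<delta> ^ n * t ^ Suc n / fact (Suc n)))"
    using assms
    by (subst nn_integral_add, simp, simp, subst nn_integral_cmult, simp,
        subst weighted_moment, simp_all add: weighted_count_moment del: fact_Suc power_Suc flip: ennreal_mult')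
  also have "\<dots> = ennreal (exp (- (\<delta> * t)) * \<delta> ^ n *
      (r ^ n * v * t ^ n / fact n + c * t ^ Suc n / fact (Suc n) * (\<Sum>i\<in>{1..n}. r ^ i))
      + c * (exp (- (\<delta> * t)) * \<delta> ^ n * t ^ Suc n / fact (Suc n)))"
    using assms \<delta>_pos
    by (intro ennreal_plus[symmetric]) (auto intro!: mult_nonneg_nonneg add_nonneg_nonneg divide_nonneg_nonneg sum_nonneg)
  also have "\<dots> = ennreal (exp (- (\<delta> * t)) * ((\<delta> * r * t) ^ n / fact n * v
       + c * \<delta> ^ n * t ^ Suc n / fact (Suc n) * (\<Sum>i\<le>n. r ^ i)))"
  proof -
    \<comment> \<open>The unfinished gap has undergone no jump and supplies the missing term i = 0
      of the geometric sum.\<close>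
    have "(\<Sum>i\<le>n. r ^ i) = 1 + (\<Sum>i\<in>{1..n}. r ^ i)"
      by (simp add: atMost_atLeast0 sum.atLeast_Suc_atMost)
    then show ?thesis
      by (simp add: algebra_simps power_mult_distrib add_divide_distrib del: fact_Suc power_Suc)
  qed
  finally show ?thesis .
qed

end

section \<open>Mean variance for fixed epochs\<close>

lemma (in prob_space) centered_normal_square:
  assumes W: "distributed M lborel W (normal_density 0 s)" and s: "s > 0"
  shows integrable_centered_normal_square: "integrable M (\<lambda>\<omega>. (b + a * W \<omega>)\<^sup>2)"
    and expectation_centered_normal_square: "expectation (\<lambda>\<omega>. (b + a * W \<omega>)\<^sup>2) = b\<^sup>2 + a\<^sup>2 * s\<^sup>2"
proof -
  have 1: "integrable M W"
    using distributed_integrable[OF W, of "\<lambda>x. x"] integrable_normal_moment[OF s, of 0 1] by simp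
  have 2: "integrable M (\<lambda>\<omega>. (W \<omega>)\<^sup>2)"
    using distributed_integrable[OF W, of "\<lambda>x. x\<^sup>2"] integrable_normal_moment[OF s, of 0 2] by simp
  have E1: "expectation W = 0"
    by (rule normal_distributed_expectation[OF s W])
  have E2: "expectation (\<lambda>\<omega>. (W \<omega>)\<^sup>2) = s\<^sup>2"
    using distributed_integral[OF W, of "\<lambda>x. x\<^sup>2", symmetric] integral_normal_moment_even[OF s, of 0 1]
    by (simp add: normal_density_nonneg)
  have eq: "(b + a * W \<omega>)\<^sup>2 = b\<^sup>2 + (2 * b * a) * W \<omega> + a\<^sup>2 * (W \<omega>)\<^sup>2" for \<omega>
    by (simp add: power2_eq_square algebra_simps)
  show "integrable M (\<lambda>\<omega>. (b + a * W \<omega>)\<^sup>2)"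
    unfolding eq using 1 2 by auto
  show "expectation (\<lambda>\<omega>. (b + a * W \<omega>)\<^sup>2) = b\<^sup>2 + a\<^sup>2 * s\<^sup>2"
    unfolding eq using 1 2 by (simp add: E1 E2 prob_space)
qed

text \<open>The noise adds N a^2 s^2 to the mean sum of squares and, since the sum of the
  \<open>Z k\<close> is normal with variance N s^2, it adds a^2 s^2 to the mean of the squared sum
  over N. The difference (N - 1) a^2 s^2 is cancelled by the normalisation of V.\<close>

lemma (in prob_space) nn_integral_sample_variance_normal:
  assumes N: "N \<ge> 2" and ind: "indep_vars (\<lambda>_. borel) Z {1..N}" and s: "s > 0"
    and Z: "\<And>k. k \<in> {1..N} \<Longrightarrow> distributed M lborel (Z k) (normal_density 0 s)"
  shows "(\<integral>\<^sup>+\<omega>. ennreal (sample_variance N (\<lambda>k. y k + a * Z k \<omega>)) \<partial>M) =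
    ennreal (sample_variance N y + a\<^sup>2 * s\<^sup>2)"
proof -
  let ?I = "{1..N}"
  define L where "L = (\<Sum>k\<in>?I. y k)"
  define Q where "Q = (\<Sum>k\<in>?I. (y k)\<^sup>2)"
  have sumZ: "distributed M lborel (\<lambda>\<omega>. \<Sum>k\<in>?I. Z k \<omega>) (normal_density 0 (sqrt (N * s\<^sup>2)))"
    using sum_indep_normal[of ?I Z "\<lambda>_. s" "\<lambda>_. 0"] N ind s Z by simp
  have sN: "sqrt (N * s\<^sup>2) > 0" using N s by simp
  have eq: "sample_variance N (\<lambda>k. y k + a * Z k \<omega>) =
      ((\<Sum>k\<in>?I. (y k + a * Z k \<omega>)\<^sup>2) - (L + a * (\<Sum>k\<in>?I. Z k \<omega>))\<^sup>2 / N) / (real N - 1)" for \<omega>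
    by (simp add: sample_variance_eq[OF N] sum.distrib L_def sum_distrib_left)
  have int: "integrable M (\<lambda>\<omega>. sample_variance N (\<lambda>k. y k + a * Z k \<omega>))"
    unfolding eq using integrable_centered_normal_square[OF Z s] integrable_centered_normal_square[OF sumZ sN]
    by (intro integrable_divide Bochner_Integration.integrable_diff Bochner_Integration.integrable_sum) auto
  have "expectation (\<lambda>\<omega>. sample_variance N (\<lambda>k. y k + a * Z k \<omega>)) =
      ((\<Sum>k\<in>?I. (y k)\<^sup>2 + a\<^sup>2 * s\<^sup>2) - (L\<^sup>2 + a\<^sup>2 * (N * s\<^sup>2)) / N) / (real N - 1)"
  proof -
    have 1: "integrable M (\<lambda>\<omega>. (y k + a * Z k \<omega>)\<^sup>2)" if "k \<in> ?I" for k
      by (rule integrable_centered_normal_square[OF Z[OF that] s])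
    have 2: "integrable M (\<lambda>\<omega>. (L + a * (\<Sum>k\<in>?I. Z k \<omega>))\<^sup>2)"
      by (rule integrable_centered_normal_square[OF sumZ sN])
    have "expectation (\<lambda>\<omega>. (\<Sum>k\<in>?I. (y k + a * Z k \<omega>)\<^sup>2)) = (\<Sum>k\<in>?I. (y k)\<^sup>2 + a\<^sup>2 * s\<^sup>2)"
      by (subst Bochner_Integration.integral_sum[OF 1]) (auto intro!: sum.cong expectation_centered_normal_square[OF Z s])
    moreover have "expectation (\<lambda>\<omega>. (L + a * (\<Sum>k\<in>?I. Z k \<omega>))\<^sup>2) = L\<^sup>2 + a\<^sup>2 * (N * s\<^sup>2)"
      using expectation_centered_normal_square[OF sumZ sN] by simp
    ultimately show ?thesis
      unfolding eq using 1 2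
      by (simp only: integral_divide_zero)
         (subst Bochner_Integration.integral_diff, auto intro!: Bochner_Integration.integrable_sum)
  qed
  also have "\<dots> = sample_variance N y + a\<^sup>2 * s\<^sup>2"
    using N by (simp add: sample_variance_eq[OF N] sum.distrib L_def field_simps)
  finally show ?thesis
    using nn_integral_eq_integral[OF int] sample_variance_nonneg[OF N] by simp
qed

text \<open>
  State just after the \<open>l\<close>-th jump, where \<open>d k i\<close> is the displacement of particle \<open>k\<close> between the
  jumps \<open>i\<close> and \<open>i + 1\<close>, while pairs are numbered from 1.
\<close>

primrec configuration ::
    "(nat \<Rightarrow> nat \<times> nat) \<Rightarrow> (nat \<Rightarrow> nat \<Rightarrow> real) \<Rightarrow> (nat \<Rightarrow> real) \<Rightarrow> nat \<Rightarrow> nat \<Rightarrow> real" where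
  "configuration \<pi> d y 0 = y"
| "configuration \<pi> d y (Suc l) = synchronize (\<pi> (Suc l)) (\<lambda>k. configuration \<pi> d y l k + d k l)"

lemma configuration_cong:
  "(\<And>i. i \<in> {1..l} \<Longrightarrow> \<pi> i = \<pi>' i) \<Longrightarrow> (\<And>k i. i < l \<Longrightarrow> d k i = d' k i) \<Longrightarrow>
    configuration \<pi> d y l = configuration \<pi>' d' y l"
  by (induction l) auto

lemma synchronize_measurable:
  assumes "\<pi> \<in> measurable S (count_space UNIV)"
    and "\<And>k. (\<lambda>z. y z k) \<in> borel_measurable S"
  shows "(\<lambda>z. synchronize (\<pi> z) (y z) k) \<in> borel_measurable S"
proof (rule measurable_compose_countable[OF _ assms(1)])
  fix ij :: "nat \<times> nat"
  obtain i j where "ij = (i, j)" by (cases ij)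
  then show "(\<lambda>z. synchronize ij (y z) k) \<in> borel_measurable S"
    using assms(2) by (cases "k = j") auto
qed

lemma configuration_measurable:
  assumes "\<And>i. i \<in> {1..l} \<Longrightarrow> (\<lambda>z. \<pi> z i) \<in> measurable S (count_space UNIV)"
    and "\<And>k i. i < l \<Longrightarrow> (\<lambda>z. d z k i) \<in> borel_measurable S"
    and "\<And>k. (\<lambda>z. y z k) \<in> borel_measurable S"
  shows "(\<lambda>z. configuration (\<pi> z) (d z) (y z) l k) \<in> borel_measurable S"
  using assms(1,2)
proof (induction l arbitrary: k)
  case 0
  show ?case using assms(3) by simp
next
  case (Suc l)
  show ?case
    unfolding configuration.simps
    by (rule synchronize_measurable) (use Suc in \<open>auto intro!: borel_measurable_add\<close>)
qed

lemma sample_variance_measurable: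
  assumes "\<And>k. k \<in> {1..N} \<Longrightarrow> (\<lambda>z. y z k) \<in> borel_measurable S"
  shows "(\<lambda>z. sample_variance N (y z)) \<in> borel_measurable S"
  unfolding sample_variance_def center_of_mass_def
  using assms
  by (intro borel_measurable_divide borel_measurable_sum borel_measurable_power borel_measurable_diff) auto

text \<open>The path \<open>b\<close> is a parameter so that both the Brownian motion and its
  regularized version can be inserted. Indices outside \<open>{1..N}\<close> get 0 because nothing
  is assumed about the process there, while measurability is later needed for every index.\<close>

definition displacement ::
    "nat \<Rightarrow> real \<Rightarrow> (nat \<Rightarrow> real \<Rightarrow> real) \<Rightarrow> (nat \<Rightarrow> real) \<Rightarrow> nat \<Rightarrow> nat \<Rightarrow> real" where
  "displacement N \<sigma> b T k l = (if k \<in> {1..N} then \<sigma> * (b k (T (Suc l)) - b k (T l)) else 0)"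

context synchronized_particles
begin

abbreviation path_displacement :: "(nat \<Rightarrow> real) \<Rightarrow> 'a \<Rightarrow> nat \<Rightarrow> nat \<Rightarrow> real" where
  "path_displacement T \<omega> \<equiv> displacement N \<sigma> (\<lambda>k s. B k s \<omega>) T"

lemma path_displacement_measurable:
  assumes "T l \<ge> 0" "T (Suc l) \<ge> 0"
  shows "(\<lambda>\<omega>. path_displacement T \<omega> k l) \<in> borel_measurable M"
  unfolding displacement_def using bm_measurable assms
  by (cases "k \<in> {1..N}") (auto intro!: borel_measurable_times borel_measurable_diff)

text \<open>The configuration after \<open>l\<close> jumps reads only increments with time index
  below \<open>l\<close>, which are independent of the increments with index \<open>l\<close>. Pairs
  and initial state are fixed here.\<close>

lemma brownian_step:
  assumes N: "N \<ge> 2" and T: "T 0 \<ge> 0" "strict_mono_on {..Suc l} T"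
  shows "(\<integral>\<^sup>+\<omega>. ennreal (sample_variance N
      (\<lambda>k. configuration \<pi> (path_displacement T \<omega>) y l k + path_displacement T \<omega> k l)) \<partial>M) =
    (\<integral>\<^sup>+\<omega>. ennreal (sample_variance N (configuration \<pi> (path_displacement T \<omega>) y l)) \<partial>M)
      + ennreal (\<sigma>\<^sup>2 * (T (Suc l) - T l))"
proof -
  define X where "X = (\<lambda>(k, i) \<omega>. B k (T (Suc i)) \<omega> - B k (T i) \<omega>)"
  \<comment> \<open>Rebuilds displacements from a family of increments, so that the integrand
    becomes a function on the product spaces to which the independence split applies.\<close>
  define E where "E u k i = (if k \<in> {1..N} then \<sigma> * u (k, i) else 0)" for u :: "nat \<times> nat \<Rightarrow> real" and k i
  let ?A = "{1..N} \<times> {..<l}" and ?C = "{1..N} \<times> {l}"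
  let ?f = "\<lambda>(u, w). ennreal (sample_variance N (\<lambda>k. configuration \<pi> (E u) y l k + E w k l))"
  have ind: "indep_vars (\<lambda>_. borel) X ({1..N} \<times> {..<Suc l})"
    unfolding X_def by (rule bm_indep) (use T in auto)
  have X: "X ki \<in> borel_measurable M" if "ki \<in> {1..N} \<times> {..<Suc l}" for ki
    using ind that unfolding indep_vars_def by blast
  have Tl: "0 \<le> T l" "T l < T (Suc l)"
    using T strict_mono_onD[OF T(2), of 0 l] strict_mono_onD[OF T(2), of l "Suc l"]
    by (cases l; force)+
  have E_measurable: "(\<lambda>u. E u k i) \<in> borel_measurable (PiM K (\<lambda>_. borel))"
    if "{1..N} \<times> {i} \<subseteq> K" for K k i
    unfolding E_def using that by (cases "k \<in> {1..N}") (auto intro!: borel_measurable_times measurable_component_singleton)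
  have f: "?f \<in> borel_measurable (PiM ?A (\<lambda>_. borel) \<Otimes>\<^sub>M PiM ?C (\<lambda>_. borel))"
    unfolding case_prod_beta
    apply (intro measurable_compose[OF _ measurable_ennreal] sample_variance_measurable
        borel_measurable_add configuration_measurable)
       apply simp
      apply (rule measurable_compose[OF measurable_fst E_measurable], force)
     apply simp
    apply (rule measurable_compose[OF measurable_snd E_measurable], simp)
    done
  have E: "E (\<lambda>ki\<in>K. X ki \<omega>) k i = path_displacement T \<omega> k i" if "{1..N} \<times> {i} \<subseteq> K" for K \<omega> k i
  proof (cases "k \<in> {1..N}")
    case True
    then have "(k, i) \<in> K" using that by auto
    with True show ?thesis by (simp add: E_def X_def displacement_def)
  qed (auto simp: E_def displacement_def)
  have conf: "configuration \<pi> (E (\<lambda>ki\<in>?A. X ki \<omega>)) y l = configuration \<pi> (path_displacement T \<omega>) y l" for \<omega>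
    by (intro configuration_cong refl E) auto
  have Z: "indep_vars (\<lambda>_. borel) (\<lambda>k. X (k, l)) {1..N}"
  proof -
    have "indep_vars (\<lambda>k. PiM {(k, l)} (\<lambda>_. borel)) (\<lambda>k \<omega>. \<lambda>ki\<in>{(k, l)}. X ki \<omega>) {1..N}"
      by (rule indep_vars_restrict[OF ind]) (auto simp: disjoint_family_on_def)
    from indep_vars_compose2[OF this, of "\<lambda>k u. u (k, l)" "\<lambda>_. borel"] show ?thesis by simp
  qed
  have "(\<integral>\<^sup>+\<omega>. ennreal (sample_variance N
      (\<lambda>k. configuration \<pi> (path_displacement T \<omega>) y l k + path_displacement T \<omega> k l)) \<partial>M) =
    (\<integral>\<^sup>+\<omega>. ?f (\<lambda>ki\<in>?A. X ki \<omega>, \<lambda>ki\<in>?C. X ki \<omega>) \<partial>M)"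
    unfolding prod.case conf by (simp add: E)
  also have "\<dots> = (\<integral>\<^sup>+\<omega>. \<integral>\<^sup>+\<omega>'. ?f (\<lambda>ki\<in>?A. X ki \<omega>, \<lambda>ki\<in>?C. X ki \<omega>') \<partial>M \<partial>M)"
    by (rule nn_integral_indep_vars_split[OF ind _ _ _ f]) auto
  also have "\<dots> = (\<integral>\<^sup>+\<omega>. ennreal (sample_variance N (configuration \<pi> (path_displacement T \<omega>) y l))
      + ennreal (\<sigma>\<^sup>2 * (T (Suc l) - T l)) \<partial>M)"
  proof (rule nn_integral_cong)
    fix \<omega>
    let ?c = "configuration \<pi> (path_displacement T \<omega>) y l"
    have "(\<integral>\<^sup>+\<omega>'. ?f (\<lambda>ki\<in>?A. X ki \<omega>, \<lambda>ki\<in>?C. X ki \<omega>') \<partial>M) =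
        (\<integral>\<^sup>+\<omega>'. ennreal (sample_variance N (\<lambda>k. ?c k + \<sigma> * X (k, l) \<omega>')) \<partial>M)"
      unfolding prod.case conf
      by (intro nn_integral_cong arg_cong[of _ _ ennreal] sample_variance_cong) (simp add: E_def)
    also have "\<dots> = ennreal (sample_variance N ?c + \<sigma>\<^sup>2 * (sqrt (T (Suc l) - T l))\<^sup>2)"
      by (rule nn_integral_sample_variance_normal[OF N Z]) (use Tl bm_increments in \<open>auto simp: X_def\<close>)
    finally show "(\<integral>\<^sup>+\<omega>'. ?f (\<lambda>ki\<in>?A. X ki \<omega>, \<lambda>ki\<in>?C. X ki \<omega>') \<partial>M) =
        ennreal (sample_variance N ?c) + ennreal (\<sigma>\<^sup>2 * (T (Suc l) - T l))"
      using Tl sample_variance_nonneg[OF N] by simp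
  qed
  also have "\<dots> = (\<integral>\<^sup>+\<omega>. ennreal (sample_variance N (configuration \<pi> (path_displacement T \<omega>) y l)) \<partial>M)
      + ennreal (\<sigma>\<^sup>2 * (T (Suc l) - T l))"
  proof (subst nn_integral_add)
    have "0 \<le> T i" if "i \<le> Suc l" for i
      using T strict_mono_onD[OF T(2), of 0 i] that by (cases i) force+
    then show "(\<lambda>\<omega>. ennreal (sample_variance N (configuration \<pi> (path_displacement T \<omega>) y l))) \<in> borel_measurable M"
      by (intro measurable_compose[OF _ measurable_ennreal] sample_variance_measurable
        configuration_measurable path_displacement_measurable) auto
  qed (simp_all add: emeasure_space_1)
  finally show ?thesis .
qed

definition retention :: real where
  "retention = 1 - 2 / (real N * (real N - 1))"

lemma retention_nonneg: "N \<ge> 2 \<Longrightarrow> retention \<ge> 0"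
proof -
  assume "N \<ge> 2"
  then have "2 * 1 \<le> real N * (real N - 1)" by (intro mult_mono) auto
  then show ?thesis by (simp add: retention_def)
qed

lemma nn_integral_synchronize_uniform:
  assumes "N \<ge> 2" "n \<ge> 1"
  shows "(\<integral>\<^sup>+\<omega>. ennreal (sample_variance N (synchronize (p n \<omega>) y)) \<partial>M) =
    ennreal (retention * sample_variance N y)"
proof -
  let ?f = "\<lambda>ij. ennreal (sample_variance N (synchronize ij y))"
  have "(\<integral>\<^sup>+\<omega>. ?f (p n \<omega>) \<partial>M) = (\<integral>\<^sup>+ij. ?f ij \<partial>distr M (count_space UNIV) (p n))"
    by (rule nn_integral_distr[symmetric]) (use p_measurable assms in auto)
  also have "\<dots> = (\<integral>\<^sup>+ij. ?f ij \<partial>measure_pmf (pmf_of_set (ordered_pairs N)))"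
    using p_uniform assms by simp
  also have "\<dots> = (\<Sum>ij\<in>ordered_pairs N. ?f ij) / card (ordered_pairs N)"
    by (rule nn_integral_pmf_of_set) (use ordered_pairs_facts assms in auto)
  also have "\<dots> = ennreal ((\<Sum>ij\<in>ordered_pairs N. sample_variance N (synchronize ij y)) / real (card (ordered_pairs N)))"
  proof -
    have "real (card (ordered_pairs N)) > 0"
      using assms(1) by (simp only: card_ordered_pairs) simp
    then show ?thesis
      using assms(1) sum_nonneg[of "ordered_pairs N" "\<lambda>ij. sample_variance N (synchronize ij y)"]
      by (subst sum_ennreal) (simp_all add: sample_variance_nonneg divide_ennreal ennreal_of_nat_eq_real_of_nat)
  qed
  also have "\<dots> = ennreal (retention * sample_variance N y)"
    using assms by (simp add: sum_sample_variance_synchronize card_ordered_pairs retention_def field_simps)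
  finally show ?thesis .
qed

text \<open>Counterpart of the Brownian step with the displacements \<open>d\<close> and
  \<open>e\<close> frozen: pair \<open>Suc l\<close> is independent of pairs 1 to \<open>l\<close>,
  which alone enter the configuration before the jump.\<close>

lemma synchronization_step:
  assumes "N \<ge> 2"
  shows "(\<integral>\<^sup>+\<omega>. ennreal (sample_variance N
      (synchronize (p (Suc l) \<omega>) (\<lambda>k. configuration (\<lambda>i. p i \<omega>) d y l k + e k))) \<partial>M) =
    ennreal retention * (\<integral>\<^sup>+\<omega>. ennreal (sample_variance N
      (\<lambda>k. configuration (\<lambda>i. p i \<omega>) d y l k + e k)) \<partial>M)"
proof -
  let ?f = "\<lambda>(u, w). ennreal (sample_variance N
      (synchronize (w (Suc l)) (\<lambda>k. configuration u d y l k + e k)))"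
  have f: "?f \<in> borel_measurable (PiM {1..l} (\<lambda>_. count_space UNIV) \<Otimes>\<^sub>M PiM {Suc l} (\<lambda>_. count_space UNIV))"
    unfolding case_prod_beta
    apply (intro measurable_compose[OF _ measurable_ennreal] sample_variance_measurable
        synchronize_measurable borel_measurable_add configuration_measurable)
        apply (rule measurable_compose[OF measurable_snd measurable_component_singleton], simp)
       apply (rule measurable_compose[OF measurable_fst measurable_component_singleton], simp)
      apply simp_all
    done
  have conf: "configuration (\<lambda>i\<in>{1..l}. p i \<omega>) d y l = configuration (\<lambda>i. p i \<omega>) d y l" for \<omega>
    by (rule configuration_cong) auto
  have "(\<integral>\<^sup>+\<omega>. ennreal (sample_variance N
      (synchronize (p (Suc l) \<omega>) (\<lambda>k. configuration (\<lambda>i. p i \<omega>) d y l k + e k))) \<partial>M) =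
      (\<integral>\<^sup>+\<omega>. ?f (\<lambda>i\<in>{1..l}. p i \<omega>, \<lambda>i\<in>{Suc l}. p i \<omega>) \<partial>M)"
    unfolding prod.case conf by simp
  also have "\<dots> = (\<integral>\<^sup>+\<omega>. \<integral>\<^sup>+\<omega>'. ?f (\<lambda>i\<in>{1..l}. p i \<omega>, \<lambda>i\<in>{Suc l}. p i \<omega>') \<partial>M \<partial>M)"
    by (rule nn_integral_indep_vars_split[OF p_indep _ _ _ f]) auto
  also have "\<dots> = (\<integral>\<^sup>+\<omega>. ennreal retention * ennreal (sample_variance N
      (\<lambda>k. configuration (\<lambda>i. p i \<omega>) d y l k + e k)) \<partial>M)"
    unfolding prod.case conf
    by (simp add: nn_integral_synchronize_uniform assms ennreal_mult retention_nonneg sample_variance_nonneg)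
  also have "\<dots> = ennreal retention * (\<integral>\<^sup>+\<omega>. ennreal (sample_variance N
      (\<lambda>k. configuration (\<lambda>i. p i \<omega>) d y l k + e k)) \<partial>M)"
    by (intro nn_integral_cmult measurable_compose[OF _ measurable_ennreal] sample_variance_measurable
        borel_measurable_add configuration_measurable) (auto intro: p_measurable)
  finally show ?thesis .
qed

text \<open>Pairs and Brownian paths live on separate copies of the sample point. Each jump
  exchanges the two integrals twice by Fubini: the pairs are moved inside to gain the factor
  \<open>retention\<close>, then the Brownian copy is moved inside to add the variance of the
  increment.\<close>

lemma mean_variance_fixed_epochs:
  assumes N: "N \<ge> 2" and T: "T 0 \<ge> 0" "strict_mono_on {..l} T"
  shows "(\<integral>\<^sup>+\<omega>. \<integral>\<^sup>+\<omega>'. ennreal (sample_variance N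
      (configuration (\<lambda>i. p i \<omega>) (path_displacement T \<omega>') y l)) \<partial>M \<partial>M) =
    ennreal (accumulated retention (\<sigma>\<^sup>2) (sample_variance N y) (\<lambda>i. T i - T (i - 1)) l)"
  using T(2)
proof (induction l)
  case 0
  show ?case by (simp add: emeasure_space_1)
next
  case (Suc l)
  let ?c = "\<lambda>\<omega> \<omega>'. configuration (\<lambda>i. p i \<omega>) (path_displacement T \<omega>') y l"
  let ?d = "\<lambda>\<omega>' k. path_displacement T \<omega>' k l"
  note inner_measurable = borel_measurable_nn_integral_fst[of _ M]
  interpret pair_sigma_finite M M ..
  have T_nonneg: "0 \<le> T i" if "i \<le> Suc l" for i
    using T(1) strict_mono_onD[OF Suc.prems, of 0 i] that by (cases i) force+
  have T_mono: "T i < T (Suc i)" if "i \<le> l" for i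
    using strict_mono_onD[OF Suc.prems, of i "Suc i"] that by simp
  have c: "(\<lambda>(\<omega>, \<omega>'). ?c \<omega> \<omega>' k) \<in> borel_measurable (M \<Otimes>\<^sub>M M)" for k
    unfolding case_prod_beta
    by (intro configuration_measurable measurable_compose[OF measurable_fst] p_measurable
      measurable_compose[OF measurable_snd path_displacement_measurable]) (auto intro: T_nonneg)
  have d: "(\<lambda>(\<omega>, \<omega>'). ?d \<omega>' k) \<in> borel_measurable (M \<Otimes>\<^sub>M M)" for k
    unfolding case_prod_beta
    by (intro measurable_compose[OF measurable_snd path_displacement_measurable]) (auto intro: T_nonneg)
  have m1: "(\<lambda>(\<omega>, \<omega>'). ennreal (sample_variance N (\<lambda>k. ?c \<omega> \<omega>' k + ?d \<omega>' k))) \<in> borel_measurable (M \<Otimes>\<^sub>M M)"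
    using c d unfolding case_prod_beta
    by (intro measurable_compose[OF _ measurable_ennreal] sample_variance_measurable borel_measurable_add) auto
  have m2: "(\<lambda>(\<omega>, \<omega>'). ennreal (sample_variance N (synchronize (p (Suc l) \<omega>) (\<lambda>k. ?c \<omega> \<omega>' k + ?d \<omega>' k))))
      \<in> borel_measurable (M \<Otimes>\<^sub>M M)"
    using c d unfolding case_prod_beta
    by (intro measurable_compose[OF _ measurable_ennreal] sample_variance_measurable borel_measurable_add
        synchronize_measurable measurable_compose[OF measurable_fst p_measurable]) auto
  have m3: "(\<lambda>(\<omega>, \<omega>'). ennreal (sample_variance N (?c \<omega> \<omega>'))) \<in> borel_measurable (M \<Otimes>\<^sub>M M)"
    using c unfolding case_prod_beta
    by (intro measurable_compose[OF _ measurable_ennreal] sample_variance_measurable) auto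
  have "(\<integral>\<^sup>+\<omega>. \<integral>\<^sup>+\<omega>'. ennreal (sample_variance N
      (configuration (\<lambda>i. p i \<omega>) (path_displacement T \<omega>') y (Suc l))) \<partial>M \<partial>M) =
    (\<integral>\<^sup>+\<omega>'. \<integral>\<^sup>+\<omega>. ennreal (sample_variance N (synchronize (p (Suc l) \<omega>) (\<lambda>k. ?c \<omega> \<omega>' k + ?d \<omega>' k))) \<partial>M \<partial>M)"
    using Fubini[OF m2] by simp
  also have "\<dots> = (\<integral>\<^sup>+\<omega>'. ennreal retention *
      (\<integral>\<^sup>+\<omega>. ennreal (sample_variance N (\<lambda>k. ?c \<omega> \<omega>' k + ?d \<omega>' k)) \<partial>M) \<partial>M)"
    by (simp only: synchronization_step[OF N])
  also have "\<dots> = ennreal retention *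
      (\<integral>\<^sup>+\<omega>'. \<integral>\<^sup>+\<omega>. ennreal (sample_variance N (\<lambda>k. ?c \<omega> \<omega>' k + ?d \<omega>' k)) \<partial>M \<partial>M)"
    using inner_measurable[OF measurable_pair_swap[OF m1]]
    by (subst nn_integral_cmult) (simp_all add: case_prod_beta)
  also have "(\<integral>\<^sup>+\<omega>'. \<integral>\<^sup>+\<omega>. ennreal (sample_variance N (\<lambda>k. ?c \<omega> \<omega>' k + ?d \<omega>' k)) \<partial>M \<partial>M) =
      (\<integral>\<^sup>+\<omega>. \<integral>\<^sup>+\<omega>'. ennreal (sample_variance N (\<lambda>k. ?c \<omega> \<omega>' k + ?d \<omega>' k)) \<partial>M \<partial>M)"
    using Fubini[OF m1] by simp
  also have "\<dots> = (\<integral>\<^sup>+\<omega>. (\<integral>\<^sup>+\<omega>'. ennreal (sample_variance N (?c \<omega> \<omega>')) \<partial>M) + ennreal (\<sigma>\<^sup>2 * (T (Suc l) - T l)) \<partial>M)"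
    by (simp only: brownian_step[OF N T(1) Suc.prems])
  also have "\<dots> = (\<integral>\<^sup>+\<omega>. \<integral>\<^sup>+\<omega>'. ennreal (sample_variance N (?c \<omega> \<omega>')) \<partial>M \<partial>M) + ennreal (\<sigma>\<^sup>2 * (T (Suc l) - T l))"
    using inner_measurable[OF m3]
    by (subst nn_integral_add) (simp_all add: case_prod_beta emeasure_space_1)
  also have "(\<integral>\<^sup>+\<omega>. \<integral>\<^sup>+\<omega>'. ennreal (sample_variance N (?c \<omega> \<omega>')) \<partial>M \<partial>M) =
      ennreal (accumulated retention (\<sigma>\<^sup>2) (sample_variance N y) (\<lambda>i. T i - T (i - 1)) l)"
    by (rule Suc.IH) (use Suc.prems in \<open>auto simp: strict_mono_on_def\<close>)
  also have "ennreal retention * (ennreal (accumulated retention (\<sigma>\<^sup>2) (sample_variance N y) (\<lambda>i. T i - T (i - 1)) l)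
      + ennreal (\<sigma>\<^sup>2 * (T (Suc l) - T l))) =
      ennreal (accumulated retention (\<sigma>\<^sup>2) (sample_variance N y) (\<lambda>i. T i - T (i - 1)) (Suc l))"
  proof -
    have "0 \<le> accumulated retention (\<sigma>\<^sup>2) (sample_variance N y) (\<lambda>i. T i - T (i - 1)) l"
    proof (rule accumulated_nonneg)
      fix i assume "i \<in> {1..l}"
      then have "T (i - 1) < T i" by (intro strict_mono_onD[OF Suc.prems]) auto
      then show "0 \<le> T i - T (i - 1)" by simp
    qed (simp_all add: retention_nonneg N sample_variance_nonneg)
    then show ?thesis
      using T_mono[of l] retention_nonneg[OF N] by (simp flip: ennreal_plus ennreal_mult)
  qed
  finally show ?case .
qed

lemma mean_variance_fixed_epochs_final:
  assumes N: "N \<ge> 2" and T: "T 0 \<ge> 0" "strict_mono_on {..n} T" "T n \<le> T (Suc n)"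
  shows "(\<integral>\<^sup>+\<omega>. \<integral>\<^sup>+\<omega>'. ennreal (sample_variance N
      (\<lambda>k. configuration (\<lambda>i. p i \<omega>) (path_displacement T \<omega>') y n k + path_displacement T \<omega>' k n)) \<partial>M \<partial>M) =
    ennreal (accumulated retention (\<sigma>\<^sup>2) (sample_variance N y) (\<lambda>i. T i - T (i - 1)) n
      + \<sigma>\<^sup>2 * (T (Suc n) - T n))"
\<comment> \<open>The time t may coincide with the last epoch. The increment is then degenerate,
  while the assumptions on Brownian increments cover only strictly increasing times.\<close>
proof (cases "T n = T (Suc n)")
  case True
  then have "path_displacement T \<omega> k n = 0" for \<omega> k by (simp add: displacement_def)
  then show ?thesis using mean_variance_fixed_epochs[OF N T(1,2)] True by simp
next
  case False
  have T': "strict_mono_on {..Suc n} T"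
  proof (rule strict_mono_onI)
    fix i j assume ij: "i \<in> {..Suc n}" "j \<in> {..Suc n}" "i < j"
    show "T i < T j"
    proof (cases "j = Suc n")
      case True
      then have "T i \<le> T n"
        using ij strict_mono_onD[OF T(2), of i n] by (cases "i = n") auto
      then show ?thesis using True False T(3) by simp
    next
      case False
      then show ?thesis using ij strict_mono_onD[OF T(2), of i j] by simp
    qed
  qed
  have T_nonneg: "0 \<le> T i" if "i \<le> Suc n" for i
    using T(1) strict_mono_onD[OF T', of 0 i] that by (cases i) force+
  have m: "(\<lambda>(\<omega>, \<omega>'). ennreal (sample_variance N (configuration (\<lambda>i. p i \<omega>) (path_displacement T \<omega>') y n)))
      \<in> borel_measurable (M \<Otimes>\<^sub>M M)"
    unfolding case_prod_beta
    by (intro measurable_compose[OF _ measurable_ennreal] sample_variance_measurable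
      configuration_measurable measurable_compose[OF measurable_fst] p_measurable
      measurable_compose[OF measurable_snd path_displacement_measurable]) (auto intro: T_nonneg)
  have "0 \<le> accumulated retention (\<sigma>\<^sup>2) (sample_variance N y) (\<lambda>i. T i - T (i - 1)) n"
  proof (rule accumulated_nonneg)
    fix i assume "i \<in> {1..n}"
    then have "T (i - 1) < T i" by (intro strict_mono_onD[OF T']) auto
    then show "0 \<le> T i - T (i - 1)" by simp
  qed (simp_all add: retention_nonneg N sample_variance_nonneg)
  moreover have "0 \<le> \<sigma>\<^sup>2 * (T (Suc n) - T n)" using T(3) by simp
  ultimately show ?thesis
    unfolding brownian_step[OF N T(1) T']
    using borel_measurable_nn_integral_fst[OF m] mean_variance_fixed_epochs[OF N T(1,2), of y]
    by (subst nn_integral_add) (simp_all add: emeasure_space_1)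
qed

end

section \<open>Decoupling the sources of randomness\<close>

text \<open>The \<open>generated_events\<close> packaged as a measurable space, so that they can be
  the target of a random variable and a factor of a product space.\<close>

definition generated_algebra :: "'a measure \<Rightarrow> 'b measure \<Rightarrow> 'i set \<Rightarrow> ('i \<Rightarrow> 'a \<Rightarrow> 'b) \<Rightarrow> 'a measure" where
  "generated_algebra M S I X = vimage_algebra (space M) (\<lambda>\<omega>. \<lambda>i\<in>I. X i \<omega>) (\<Pi>\<^sub>M i\<in>I. S)"

lemma sets_generated_algebra: "sets (generated_algebra M S I X) = generated_events M S I X"
  and space_generated_algebra: "space (generated_algebra M S I X) = space M"
  by (simp_all add: generated_algebra_def generated_events_def)

lemma measurable_generated_algebra:
  assumes "i \<in> I" and X: "\<And>i. i \<in> I \<Longrightarrow> X i \<in> space M \<rightarrow> space S"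
  shows "X i \<in> measurable (generated_algebra M S I X) S"
proof -
  have "(\<lambda>\<omega>. \<lambda>i\<in>I. X i \<omega>) \<in> measurable (generated_algebra M S I X) (\<Pi>\<^sub>M i\<in>I. S)"
    unfolding generated_algebra_def
    by (rule measurable_vimage_algebra1) (auto simp: space_PiM dest: X[THEN funcset_mem])
  from measurable_compose[OF this measurable_component_singleton[OF assms(1)]] show ?thesis
    using assms(1) by simp
qed

lemma measurable_id_generated_algebra:
  assumes "\<And>i. i \<in> I \<Longrightarrow> X i \<in> measurable M S"
  shows "(\<lambda>\<omega>. \<omega>) \<in> measurable M (generated_algebra M S I X)"
  unfolding generated_algebra_def
  by (rule measurable_vimage_algebra2) (use assms in \<open>auto intro!: measurable_restrict\<close>)

text \<open>The values lie in a countable set of nonnegative times. Countability gives measurability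
  after inserting a random time; nonnegativity keeps the path inside the domain where it is
  continuous.\<close>

definition dyadic :: "nat \<Rightarrow> real \<Rightarrow> real" where
  "dyadic m s = real (nat \<lceil>2 ^ m * s\<rceil>) / 2 ^ m"

lemma dyadic_nonneg: "dyadic m s \<ge> 0"
  by (simp add: dyadic_def)

lemma dyadic_tendsto:
  assumes "s \<ge> 0"
  shows "(\<lambda>m. dyadic m s) \<longlonglongrightarrow> s"
proof (rule tendsto_sandwich)
  have *: "s \<le> dyadic m s \<and> dyadic m s \<le> s + (1 / 2) ^ m" for m
  proof -
    have "real (nat \<lceil>2 ^ m * s\<rceil>) = of_int \<lceil>2 ^ m * s\<rceil>"
      using assms by (simp add: of_nat_nat)
    then have "2 ^ m * s \<le> real (nat \<lceil>2 ^ m * s\<rceil>)" "real (nat \<lceil>2 ^ m * s\<rceil>) \<le> 2 ^ m * s + 1"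
      by linarith+
    then show ?thesis by (simp add: dyadic_def field_simps power_divide)
  qed
  show "\<forall>\<^sub>F m in sequentially. s \<le> dyadic m s" "\<forall>\<^sub>F m in sequentially. dyadic m s \<le> s + (1 / 2) ^ m"
    using * by simp_all
  have "(\<lambda>m. s + (1 / 2) ^ m) \<longlonglongrightarrow> s + 0"
    by (intro tendsto_add tendsto_const LIMSEQ_power_zero) simp
  then show "(\<lambda>m. s + (1 / 2) ^ m) \<longlonglongrightarrow> s" by simp
qed simp

context synchronized_particles
begin

abbreviation "brownian_algebra \<equiv> generated_algebra M borel ({1..N} \<times> {0..}) (\<lambda>(k, t). B k t)"
abbreviation "epoch_algebra \<equiv> generated_algebra M borel UNIV \<tau>"
abbreviation "initial_algebra \<equiv> generated_algebra M borel {1..N} (\<lambda>k. x k 0)"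
abbreviation "pair_algebra \<equiv> generated_algebra M (count_space UNIV) {1..} p"

text \<open>Independence of the sources is used in the form that the identity maps into the four
  \<open>\<sigma>\<close>-algebras are independent random variables.\<close>

lemma nn_integral_decouple:
  assumes f: "f \<in> borel_measurable (epoch_algebra \<Otimes>\<^sub>M initial_algebra \<Otimes>\<^sub>M pair_algebra \<Otimes>\<^sub>M brownian_algebra)"
  shows "(\<integral>\<^sup>+\<omega>. f (\<omega>, \<omega>, \<omega>, \<omega>) \<partial>M) =
    (\<integral>\<^sup>+\<omega>1. \<integral>\<^sup>+\<omega>2. \<integral>\<^sup>+\<omega>3. \<integral>\<^sup>+\<omega>4. f (\<omega>1, \<omega>2, \<omega>3, \<omega>4) \<partial>M \<partial>M \<partial>M \<partial>M)"
proof -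
  let ?V = "(!) [brownian_algebra, epoch_algebra, initial_algebra, pair_algebra]"
  have four: "i < 4 \<longleftrightarrow> i = 0 \<or> i = 1 \<or> i = 2 \<or> i = 3" for i :: nat by auto
  have "indep_vars ?V (\<lambda>_ \<omega>. \<omega>) {..<4}"
    unfolding indep_vars_def2
  proof
    show "\<forall>i\<in>{..<4}. random_variable (?V i) (\<lambda>\<omega>. \<omega>)"
      using bm_measurable \<tau>_measurable x_measurable p_measurable
      by (auto simp: four intro!: measurable_id_generated_algebra)
    show "indep_sets (\<lambda>i. {(\<lambda>\<omega>. \<omega>) -` A \<inter> space M |A. A \<in> sets (?V i)}) {..<4}"
    proof (rule indep_sets_mono_sets[OF mutual_indep])
      fix i :: nat assume "i \<in> {..<4}"
      have "A \<inter> space M = A" if "A \<in> sets (?V i)" for A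
      proof -
        have "space (?V i) = space M"
          using \<open>i \<in> {..<4}\<close> by (auto simp: four space_generated_algebra)
        then show ?thesis using sets.sets_into_space[OF that] by auto
      qed
      moreover have "[generated_events M borel ({1..N} \<times> {0..}) (\<lambda>(k, t). B k t),
         generated_events M borel UNIV \<tau>,
         generated_events M borel {1..N} (\<lambda>k. x k 0),
         generated_events M (count_space UNIV) {1..} p] ! i = sets (?V i)"
        using \<open>i \<in> {..<4}\<close> by (auto simp: four sets_generated_algebra)
      ultimately show "{(\<lambda>\<omega>. \<omega>) -` A \<inter> space M |A. A \<in> sets (?V i)} \<subseteq>
        [generated_events M borel ({1..N} \<times> {0..}) (\<lambda>(k, t). B k t),
         generated_events M borel UNIV \<tau>,
         generated_events M borel {1..N} (\<lambda>k. x k 0),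
         generated_events M (count_space UNIV) {1..} p] ! i"
        by auto
    qed
  qed
  \<comment> \<open>The Brownian source has index 0 in the list but is integrated innermost, next to
    the pairs, which is the order in which the results for fixed epochs are stated.\<close>
  from nn_integral_indep_vars4[OF this, of 1 2 3 0 f] f show ?thesis by simp
qed

text \<open>
  The Brownian path is evaluated at random epochs, which requires joint measurability in time and
  in the \<open>\<sigma>\<close>-algebra generated by \<open>B\<close>. Since \<open>B\<close> is continuous only almost surely, it is replaced by
  the limit along dyadic times; where the limit does not exist \<open>lim\<close> is an unspecified value.
\<close>

definition regularized :: "'a \<Rightarrow> nat \<Rightarrow> real \<Rightarrow> real" where
  "regularized \<omega> k s = lim (\<lambda>m. B k (dyadic m s) \<omega>)"

text \<open>The exceptional null set does not depend on the time \<open>s\<close>; this makes the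
  statement usable at random epochs.\<close>

lemma AE_regularized: "AE \<omega> in M. \<forall>k\<in>{1..N}. \<forall>s\<ge>0. regularized \<omega> k s = B k s \<omega>"
proof -
  have "AE \<omega> in M. \<forall>k\<in>{1..N}. continuous_on {0..} (\<lambda>s. B k s \<omega>)"
    by (subst AE_finite_all) (auto intro: bm_continuous)
  then show ?thesis
  proof eventually_elim
    case (elim \<omega>)
    have "(\<lambda>m. B k (dyadic m s) \<omega>) \<longlonglongrightarrow> B k s \<omega>" if "k \<in> {1..N}" "s \<ge> 0" for k s
      using continuous_on_tendsto_compose[OF bspec[OF elim that(1)] dyadic_tendsto[OF that(2)]]
        that(2) dyadic_nonneg by auto
    then show ?case unfolding regularized_def by (auto intro: limI)
  qed
qed

text \<open>For each \<open>m\<close> the rounded time takes countably many values, at each of which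
  the path is measurable for \<open>brownian_algebra\<close>; \<open>lim\<close> of measurable
  functions is measurable whether or not it converges.\<close>

lemma regularized_measurable:
  assumes k: "k \<in> {1..N}"
    and b: "b \<in> measurable S brownian_algebra" and s: "s \<in> borel_measurable S"
  shows "(\<lambda>z. regularized (b z) k (s z)) \<in> borel_measurable S"
  unfolding regularized_def
proof (rule borel_measurable_lim_metric)
  fix m
  have "B k (real i / 2 ^ m) \<in> borel_measurable brownian_algebra" for i
    using measurable_generated_algebra[of "(k, real i / 2 ^ m)" "{1..N} \<times> {0..}" "\<lambda>(k, t). B k t" M borel] k
    by auto
  then have "(\<lambda>z. B k (real i / 2 ^ m) (b z)) \<in> borel_measurable S" for i
    by (rule measurable_compose[OF b])
  moreover have "(\<lambda>z. nat \<lceil>2 ^ m * s z\<rceil>) \<in> measurable S (count_space UNIV)"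
    using s by measurable
  ultimately show "(\<lambda>z. B k (dyadic m (s z)) (b z)) \<in> borel_measurable S"
    unfolding dyadic_def by (rule measurable_compose_countable)
qed

definition initial :: "'a \<Rightarrow> nat \<Rightarrow> real" where
  "initial \<omega> k = (if k \<in> {1..N} then x k 0 \<omega> else 0)"

text \<open>Appending t after epoch n turns the unfinished free motion into the displacement with
  index n, of the same form as those between jumps.\<close>

definition clock :: "nat \<Rightarrow> real \<Rightarrow> 'a \<Rightarrow> nat \<Rightarrow> real" where
  "clock n t \<omega> l = (if l \<le> n then \<tau> l \<omega> else t)"

lemma AE_pairs: "N \<ge> 2 \<Longrightarrow> AE \<omega> in M. \<forall>n\<ge>1. p n \<omega> \<in> ordered_pairs N"
proof -
  assume N: "N \<ge> 2"
  have "AE \<omega> in M. p n \<omega> \<in> ordered_pairs N" if "n \<ge> 1" for n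
  proof -
    have "AE ij in distr M (count_space UNIV) (p n). ij \<in> ordered_pairs N"
      unfolding p_uniform[OF that]
      by (simp add: AE_measure_pmf_iff set_pmf_of_set ordered_pairs_facts[OF N])
    then show ?thesis
      by (subst (asm) AE_distr_iff) (use p_measurable[OF that] in auto)
  qed
  then show ?thesis by (simp add: AE_all_countable)
qed

text \<open>A jump prescribes the new position as a left limit. Free motion up to the next epoch and
  continuity of the path determine the same left limit, so uniqueness of limits gives one step of
  \<open>configuration\<close>. Free motion can be applied to the source particle because almost
  surely all pairs are admissible.\<close>

lemma AE_position_at_epochs:
  assumes N: "N \<ge> 2"
  shows "AE \<omega> in M. \<forall>l. \<forall>k\<in>{1..N}. x k (\<tau> l \<omega>) \<omega> =
    configuration (\<lambda>i. p i \<omega>) (path_displacement (\<lambda>i. \<tau> i \<omega>) \<omega>) (initial \<omega>) l k"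
proof -
  have "AE \<omega> in M. \<forall>k\<in>{1..N}. continuous_on {0..} (\<lambda>s. B k s \<omega>)"
    by (subst AE_finite_all) (auto intro: bm_continuous)
  with \<tau>_increasing AE_pairs[OF N] free_motion jumps show ?thesis
  proof eventually_elim
    case (elim \<omega>)
    let ?c = "configuration (\<lambda>i. p i \<omega>) (path_displacement (\<lambda>i. \<tau> i \<omega>) \<omega>) (initial \<omega>)"
    have \<tau>0: "\<tau> 0 \<omega> = 0" and mono: "strict_mono (\<lambda>n. \<tau> n \<omega>)" using elim by auto
    have \<tau>_nonneg: "0 \<le> \<tau> l \<omega>" for l
      using strict_mono_mono[OF mono] \<tau>0 by (metis monoD zero_le)
    have "\<forall>k\<in>{1..N}. x k (\<tau> l \<omega>) \<omega> = ?c l k" for l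
    proof (induction l)
      case 0
      show ?case by (simp add: \<tau>0 initial_def)
    next
      case (Suc l)
      obtain i j where ij: "p (Suc l) \<omega> = (i, j)" by (cases "p (Suc l) \<omega>")
      then have range: "i \<in> {1..N}" "j \<in> {1..N}" "i \<noteq> j"
        using elim(2)[rule_format, of "Suc l"] by (auto simp: ordered_pairs_def)
      have less: "\<tau> l \<omega> < \<tau> (Suc l) \<omega>" using mono by (simp add: strict_mono_def)
      have left: "((\<lambda>s. x k s \<omega>) \<longlongrightarrow> ?c l k + path_displacement (\<lambda>i. \<tau> i \<omega>) \<omega> k l) (at_left (\<tau> (Suc l) \<omega>))"
        if k: "k \<in> {1..N}" for k
      proof -
        have ev: "\<forall>\<^sub>F s in at_left (\<tau> (Suc l) \<omega>). s \<in> {\<tau> l \<omega><..<\<tau> (Suc l) \<omega>}"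
          using eventually_at_left_real[OF less] .
        have "continuous (at (\<tau> (Suc l) \<omega>) within {0..}) (\<lambda>s. B k s \<omega>)"
          using elim(5) k \<tau>_nonneg[of "Suc l"] by (simp add: continuous_on_eq_continuous_within)
        then have "((\<lambda>s. B k s \<omega>) \<longlongrightarrow> B k (\<tau> (Suc l) \<omega>) \<omega>) (at (\<tau> (Suc l) \<omega>) within {0..})"
          by (simp add: continuous_within)
        then have "((\<lambda>s. B k s \<omega>) \<longlongrightarrow> B k (\<tau> (Suc l) \<omega>) \<omega>) (at (\<tau> (Suc l) \<omega>) within {\<tau> l \<omega>..\<tau> (Suc l) \<omega>})"
          by (rule tendsto_within_subset) (use \<tau>_nonneg[of l] in auto)
        then have "((\<lambda>s. B k s \<omega>) \<longlongrightarrow> B k (\<tau> (Suc l) \<omega>) \<omega>) (at_left (\<tau> (Suc l) \<omega>))"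
          using at_within_Icc_at_left[OF less] by simp
        then have "((\<lambda>s. ?c l k + \<sigma> * (B k s \<omega> - B k (\<tau> l \<omega>) \<omega>)) \<longlongrightarrow>
            ?c l k + \<sigma> * (B k (\<tau> (Suc l) \<omega>) \<omega> - B k (\<tau> l \<omega>) \<omega>)) (at_left (\<tau> (Suc l) \<omega>))"
          by (intro tendsto_intros)
        moreover have "\<forall>\<^sub>F s in at_left (\<tau> (Suc l) \<omega>).
            ?c l k + \<sigma> * (B k s \<omega> - B k (\<tau> l \<omega>) \<omega>) = x k s \<omega>"
          using ev
        proof eventually_elim
          case (elim s)
          then have "x k s \<omega> - x k (\<tau> l \<omega>) \<omega> = \<sigma> * (B k s \<omega> - B k (\<tau> l \<omega>) \<omega>)"
            using \<open>\<forall>n. \<forall>s\<in>{\<tau> n \<omega>..<\<tau> (Suc n) \<omega>}. \<forall>k\<in>{1..N}.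
              x k s \<omega> - x k (\<tau> n \<omega>) \<omega> = \<sigma> * (B k s \<omega> - B k (\<tau> n \<omega>) \<omega>)\<close> k by auto
          with Suc.IH k show ?case by simp
        qed
        ultimately show ?thesis
          using k by (simp add: displacement_def tendsto_cong)
      qed
      have jump: "((\<lambda>s. x i s \<omega>) \<longlongrightarrow> x j (\<tau> (Suc l) \<omega>) \<omega>) (at_left (\<tau> (Suc l) \<omega>))"
        "\<And>m. m \<in> {1..N} - {j} \<Longrightarrow> ((\<lambda>s. x m s \<omega>) \<longlongrightarrow> x m (\<tau> (Suc l) \<omega>) \<omega>) (at_left (\<tau> (Suc l) \<omega>))"
        using elim(4)[rule_format, of "Suc l"] ij by auto
      have nontrivial: "at_left (\<tau> (Suc l) \<omega>) \<noteq> bot" by simp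
      show ?case
      proof
        fix k assume k: "k \<in> {1..N}"
        show "x k (\<tau> (Suc l) \<omega>) \<omega> = ?c (Suc l) k"
        proof (cases "k = j")
          case True
          then show ?thesis
            using tendsto_unique[OF nontrivial jump(1) left[OF range(1)]] by (simp add: ij)
        next
          case False
          then show ?thesis
            using tendsto_unique[OF nontrivial jump(2) left[OF k]] k by (simp add: ij)
        qed
      qed
    qed
    then show ?case by blast
  qed
qed

lemma AE_position:
  assumes N: "N \<ge> 2" and t: "t \<ge> 0"
  shows "AE \<omega> in M. \<tau> n \<omega> \<le> t \<and> t < \<tau> (Suc n) \<omega> \<longrightarrow>
    sample_variance N (\<lambda>k. x k t \<omega>) = sample_variance N (\<lambda>k.
      configuration (\<lambda>i. p i \<omega>) (displacement N \<sigma> (regularized \<omega>) (clock n t \<omega>)) (initial \<omega>) n k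
        + displacement N \<sigma> (regularized \<omega>) (clock n t \<omega>) k n)"
  using \<tau>_increasing AE_regularized AE_position_at_epochs[OF N] free_motion
proof eventually_elim
  case (elim \<omega>)
  have \<tau>0: "\<tau> 0 \<omega> = 0" and mono: "strict_mono (\<lambda>n. \<tau> n \<omega>)" using elim by auto
  have \<tau>_nonneg: "0 \<le> \<tau> l \<omega>" for l
    using strict_mono_mono[OF mono] \<tau>0 by (metis monoD zero_le)
  show ?case
  proof (intro impI sample_variance_cong)
    fix k assume between: "\<tau> n \<omega> \<le> t \<and> t < \<tau> (Suc n) \<omega>" and k: "k \<in> {1..N}"
    have "configuration (\<lambda>i. p i \<omega>) (displacement N \<sigma> (regularized \<omega>) (clock n t \<omega>)) (initial \<omega>) n =
        configuration (\<lambda>i. p i \<omega>) (path_displacement (\<lambda>i. \<tau> i \<omega>) \<omega>) (initial \<omega>) n"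
      using elim(2) \<tau>_nonneg by (intro configuration_cong) (auto simp: displacement_def clock_def)
    moreover have "displacement N \<sigma> (regularized \<omega>) (clock n t \<omega>) k n = \<sigma> * (B k t \<omega> - B k (\<tau> n \<omega>) \<omega>)"
      using elim(2) \<tau>_nonneg t k by (simp add: displacement_def clock_def)
    moreover have "x k t \<omega> - x k (\<tau> n \<omega>) \<omega> = \<sigma> * (B k t \<omega> - B k (\<tau> n \<omega>) \<omega>)"
      using elim(4) between k by simp
    ultimately show "x k t \<omega> =
      configuration (\<lambda>i. p i \<omega>) (displacement N \<sigma> (regularized \<omega>) (clock n t \<omega>)) (initial \<omega>) n k
        + displacement N \<sigma> (regularized \<omega>) (clock n t \<omega>) k n"
      using elim(3) k by simp
  qed
qed

end

section \<open>Closed form of the mean variance and its asymptotics\<close>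

text \<open>Since the initial variance enters affinely, integrating over the initial state merely
  replaces it by its mean.\<close>

lemma accumulated_affine: "accumulated r c v g n = r ^ n * v + accumulated r c 0 g n"
  by (induction n) (simp_all add: algebra_simps)

context synchronized_particles
begin

text \<open>After decoupling, the outermost copy fixes the epochs as deterministic times. The two
  innermost integrals are then the case of fixed epochs with a given initial state, and the
  remaining one averages over that state.\<close>

lemma nn_integral_sample_variance_between_epochs:
  assumes N: "N \<ge> 2" and t: "t \<ge> 0" and v: "mean_variance M N x 0 = ennreal v" "v \<ge> 0"
  shows "(\<integral>\<^sup>+\<omega>. indicator {\<omega>. \<tau> n \<omega> \<le> t \<and> t < \<tau> (Suc n) \<omega>} \<omega> *
      ennreal (sample_variance N (\<lambda>k. x k t \<omega>)) \<partial>M) =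
    (\<integral>\<^sup>+\<omega>. indicator {\<omega>. \<tau> n \<omega> \<le> t \<and> t < \<tau> (Suc n) \<omega>} \<omega> *
      ennreal (accumulated retention (\<sigma>\<^sup>2) v (\<lambda>i. \<tau> i \<omega> - \<tau> (i - 1) \<omega>) n + \<sigma>\<^sup>2 * (t - \<tau> n \<omega>)) \<partial>M)"
proof -
  let ?I = "\<lambda>\<omega>. indicator {\<omega>. \<tau> n \<omega> \<le> t \<and> t < \<tau> (Suc n) \<omega>} \<omega> :: ennreal"
  let ?S = "epoch_algebra \<Otimes>\<^sub>M initial_algebra \<Otimes>\<^sub>M pair_algebra \<Otimes>\<^sub>M brownian_algebra"
  let ?V = "\<lambda>\<omega>1 \<omega>2 \<omega>3 b. ennreal (sample_variance N (\<lambda>k.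
    configuration (\<lambda>i. p i \<omega>3) (displacement N \<sigma> b (clock n t \<omega>1)) (initial \<omega>2) n k
      + displacement N \<sigma> b (clock n t \<omega>1) k n))"
  let ?f = "\<lambda>z. ?I (fst z) * ?V (fst z) (fst (snd z)) (fst (snd (snd z))) (regularized (snd (snd (snd z))))"
  let ?a = "\<lambda>\<omega> v. accumulated retention (\<sigma>\<^sup>2) v (\<lambda>i. \<tau> i \<omega> - \<tau> (i - 1) \<omega>) n"
  have \<tau>_epoch [measurable]: "\<tau> l \<in> borel_measurable epoch_algebra" for l
    by (rule measurable_generated_algebra) auto
  have I: "?I \<in> borel_measurable epoch_algebra"
    unfolding indicator_def mem_Collect_eq by measurable
  have clock: "(\<lambda>\<omega>. clock n t \<omega> l) \<in> borel_measurable epoch_algebra" for l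
    by (cases "l \<le> n") (auto simp: clock_def[abs_def])
  have initial: "(\<lambda>\<omega>. initial \<omega> k) \<in> borel_measurable initial_algebra" for k
    using measurable_generated_algebra[of k "{1..N}" "\<lambda>k. x k 0" M borel]
    by (cases "k \<in> {1..N}") (auto simp: initial_def[abs_def])
  have pair: "p i \<in> measurable pair_algebra (count_space UNIV)" if "i \<ge> 1" for i
    by (rule measurable_generated_algebra) (use that in auto)
  have disp: "(\<lambda>z. displacement N \<sigma> (regularized (snd (snd (snd z)))) (clock n t (fst z)) k l) \<in> borel_measurable ?S" for k l
    unfolding displacement_def
    by (cases "k \<in> {1..N}")
       (auto intro!: borel_measurable_times borel_measurable_diff regularized_measurable
         measurable_compose[OF measurable_fst clock])
  have f: "?f \<in> borel_measurable ?S"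
    by (intro borel_measurable_times_ennreal measurable_compose[OF measurable_fst I]
        measurable_compose[OF _ measurable_ennreal] sample_variance_measurable
        borel_measurable_add configuration_measurable disp
        measurable_compose[OF measurable_snd measurable_compose[OF measurable_fst initial]]
        measurable_compose[OF measurable_snd measurable_compose[OF measurable_snd measurable_compose[OF measurable_fst pair]]])
       auto
  have "(\<integral>\<^sup>+\<omega>. ?I \<omega> * ennreal (sample_variance N (\<lambda>k. x k t \<omega>)) \<partial>M) = (\<integral>\<^sup>+\<omega>. ?f (\<omega>, \<omega>, \<omega>, \<omega>) \<partial>M)"
  proof (rule nn_integral_cong_AE, use AE_position[OF N t, of n] in eventually_elim)
    case (elim \<omega>)
    then show ?case by (auto simp: indicator_def)
  qed
  also have "\<dots> = (\<integral>\<^sup>+\<omega>1. \<integral>\<^sup>+\<omega>2. \<integral>\<^sup>+\<omega>3. \<integral>\<^sup>+\<omega>4. ?f (\<omega>1, \<omega>2, \<omega>3, \<omega>4) \<partial>M \<partial>M \<partial>M \<partial>M)"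
    by (rule nn_integral_decouple[OF f])
  also have "\<dots> = (\<integral>\<^sup>+\<omega>. ?I \<omega> * ennreal (?a \<omega> v + \<sigma>\<^sup>2 * (t - \<tau> n \<omega>)) \<partial>M)"
  proof (rule nn_integral_cong_AE, use \<tau>_increasing in eventually_elim)
    case (elim \<omega>1)
    have \<tau>0: "\<tau> 0 \<omega>1 = 0" and mono: "strict_mono (\<lambda>n. \<tau> n \<omega>1)" using elim by auto
    have \<tau>_nonneg: "0 \<le> \<tau> l \<omega>1" for l
      using strict_mono_mono[OF mono] \<tau>0 by (metis monoD zero_le)
    have clock_nonneg: "0 \<le> clock n t \<omega>1 l" for l using \<tau>_nonneg t by (simp add: clock_def)
    show ?case
    proof (cases "\<tau> n \<omega>1 \<le> t \<and> t < \<tau> (Suc n) \<omega>1")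
      case False
      then show ?thesis by simp
    next
      case True
      then have I1: "?I \<omega>1 = 1" by simp
      let ?K = "?a \<omega>1 0 + \<sigma>\<^sup>2 * (t - \<tau> n \<omega>1)"
      have "0 \<le> ?a \<omega>1 0"
      proof (rule accumulated_nonneg)
        fix i assume "i \<in> {1..n}"
        then have "\<tau> (i - 1) \<omega>1 < \<tau> i \<omega>1" by (intro strict_monoD[OF mono]) auto
        then show "0 \<le> \<tau> i \<omega>1 - \<tau> (i - 1) \<omega>1" by simp
      qed (simp_all add: retention_nonneg N)
      with True have K: "0 \<le> ?K" by simp
      have V: "(\<integral>\<^sup>+\<omega>3. \<integral>\<^sup>+\<omega>4. ?f (\<omega>1, \<omega>2, \<omega>3, \<omega>4) \<partial>M \<partial>M) =
          ennreal (retention ^ n) * ennreal (sample_variance N (\<lambda>k. x k 0 \<omega>2)) + ennreal ?K" for \<omega>2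
      proof -
        have "(\<integral>\<^sup>+\<omega>3. \<integral>\<^sup>+\<omega>4. ?f (\<omega>1, \<omega>2, \<omega>3, \<omega>4) \<partial>M \<partial>M) =
            (\<integral>\<^sup>+\<omega>3. \<integral>\<^sup>+\<omega>4. ?V \<omega>1 \<omega>2 \<omega>3 (\<lambda>k s. B k s \<omega>4) \<partial>M \<partial>M)"
        \<comment> \<open>The regularization has served its purpose: with \<open>\<omega>1\<close>
          fixed all clock times are deterministic and nonnegative, and the innermost integral may
          return to \<open>B\<close>.\<close>
        proof (rule nn_integral_cong, rule nn_integral_cong_AE, use AE_regularized in eventually_elim)
          case (elim \<omega>3 \<omega>4)
          then have "displacement N \<sigma> (regularized \<omega>4) (clock n t \<omega>1) = path_displacement (clock n t \<omega>1) \<omega>4"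
            using clock_nonneg by (auto simp: displacement_def fun_eq_iff)
          then show ?case using I1 by simp
        qed
        also have "\<dots> = ennreal (accumulated retention (\<sigma>\<^sup>2) (sample_variance N (initial \<omega>2))
            (\<lambda>i. clock n t \<omega>1 i - clock n t \<omega>1 (i - 1)) n + \<sigma>\<^sup>2 * (clock n t \<omega>1 (Suc n) - clock n t \<omega>1 n))"
          by (rule mean_variance_fixed_epochs_final[OF N clock_nonneg])
             (use True in \<open>auto simp: clock_def strict_mono_on_def strict_monoD[OF mono]\<close>)
        also have "accumulated retention (\<sigma>\<^sup>2) (sample_variance N (initial \<omega>2))
            (\<lambda>i. clock n t \<omega>1 i - clock n t \<omega>1 (i - 1)) n = ?a \<omega>1 (sample_variance N (initial \<omega>2))"
          by (rule accumulated_cong) (auto simp: clock_def)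
        also have "clock n t \<omega>1 (Suc n) - clock n t \<omega>1 n = t - \<tau> n \<omega>1"
          by (simp add: clock_def)
        also have "sample_variance N (initial \<omega>2) = sample_variance N (\<lambda>k. x k 0 \<omega>2)"
          by (rule sample_variance_cong) (simp add: initial_def)
        finally show ?thesis
          using K retention_nonneg[OF N] sample_variance_nonneg[OF N]
          by (subst (asm) accumulated_affine) (simp add: add.assoc flip: ennreal_mult ennreal_plus)
      qed
      have "(\<lambda>\<omega>2. ennreal (sample_variance N (\<lambda>k. x k 0 \<omega>2))) \<in> borel_measurable M"
        using x_measurable by (intro measurable_compose[OF _ measurable_ennreal] sample_variance_measurable) auto
      then have "(\<integral>\<^sup>+\<omega>2. \<integral>\<^sup>+\<omega>3. \<integral>\<^sup>+\<omega>4. ?f (\<omega>1, \<omega>2, \<omega>3, \<omega>4) \<partial>M \<partial>M \<partial>M) =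
          ennreal (retention ^ n) * mean_variance M N x 0 + ennreal ?K"
        unfolding V mean_variance_def
        by (subst nn_integral_add) (simp_all add: nn_integral_cmult emeasure_space_1)
      also have "\<dots> = ennreal (?a \<omega>1 v + \<sigma>\<^sup>2 * (t - \<tau> n \<omega>1))"
        unfolding v(1) using K v(2) retention_nonneg[OF N]
        by (subst (2) accumulated_affine) (simp add: add.assoc flip: ennreal_mult ennreal_plus)
      finally show ?thesis using I1 by simp
    qed
  qed
  finally show ?thesis .
qed

theorem mean_variance_formula:
  assumes N: "N \<ge> 2" and \<delta>: "\<delta> > 0" and t: "t \<ge> 0"
    and v: "mean_variance M N x 0 = ennreal v" "v \<ge> 0"
  defines "\<theta> \<equiv> 2 * \<delta> / (real N * (real N - 1))"
  shows "mean_variance M N x t = ennreal (exp (- (\<theta> * t)) * v + \<sigma>\<^sup>2 * (1 - exp (- (\<theta> * t))) / \<theta>)"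
proof -
  interpret gaps: poisson_gaps M "\<lambda>i \<omega>. \<tau> i \<omega> - \<tau> (i - 1) \<omega>" \<delta>
    by unfold_locales (use \<delta> \<tau>_indep \<tau>_increments in auto)
  define E where "E n = {\<omega> \<in> space M. \<tau> n \<omega> \<le> t \<and> t < \<tau> (Suc n) \<omega>}" for n
  have E_sets [measurable]: "E n \<in> sets M" for n
    unfolding E_def using \<tau>_measurable by measurable
  have epoch: "AE \<omega> in M. \<forall>n. gaps.epoch n \<omega> = \<tau> n \<omega>"
    using \<tau>_increasing
  proof eventually_elim
    case (elim \<omega>)
    have "gaps.epoch n \<omega> = \<tau> n \<omega>" for n
      using elim by (induction n) (simp_all add: gaps.epoch_def del: One_nat_def)
    then show ?case by blast
  qed
  have integral_E: "(\<integral>\<^sup>+\<omega>. indicator {\<omega>. \<tau> n \<omega> \<le> t \<and> t < \<tau> (Suc n) \<omega>} \<omega> *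
      ennreal (accumulated r c w (\<lambda>i. \<tau> i \<omega> - \<tau> (i - 1) \<omega>) n + c * (t - \<tau> n \<omega>)) \<partial>M) =
    ennreal (exp (- (\<delta> * t)) * ((\<delta> * r * t) ^ n / fact n * w
       + c * \<delta> ^ n * t ^ Suc n / fact (Suc n) * (\<Sum>i\<le>n. r ^ i)))"
    if "r \<ge> 0" "c \<ge> 0" "w \<ge> 0" for r c w n
    unfolding gaps.nn_integral_between_epochs[OF that t, of n, symmetric]
  proof (rule nn_integral_cong_AE, use epoch in eventually_elim)
    case (elim \<omega>)
    then show ?case by (simp add: indicator_def)
  qed
  have disjoint: "AE \<omega> in M. \<omega> \<in> space M \<and> (\<forall>m n. \<omega> \<in> E m \<longrightarrow> \<omega> \<in> E n \<longrightarrow> m = n)"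
    using \<tau>_increasing AE_space
  proof eventually_elim
    case (elim \<omega>)
    then have mono: "mono (\<lambda>n. \<tau> n \<omega>)" by (auto intro: strict_mono_mono)
    have "m \<le> n" if "\<omega> \<in> E m" "\<omega> \<in> E n" for m n
    proof (rule ccontr)
      assume "\<not> m \<le> n"
      then have "\<tau> (Suc n) \<omega> \<le> \<tau> m \<omega>" by (intro monoD[OF mono]) auto
      with that show False by (auto simp: E_def)
    qed
    then show ?case using elim by (auto intro: antisym)
  qed
  have single: "(\<Sum>n. indicator (E n) \<omega> * a) = a"
    if "\<omega> \<in> E m" "\<forall>m n. \<omega> \<in> E m \<longrightarrow> \<omega> \<in> E n \<longrightarrow> m = n" for \<omega> m and a :: ennreal
  proof -
    have "(\<lambda>n. indicator (E n) \<omega> * a) = (\<lambda>n. if n = m then a else 0)"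
      using that by (auto simp: fun_eq_iff indicator_def)
    then show ?thesis using sums_single[of m "\<lambda>_. a"] by (simp add: sums_iff)
  qed
  have exp_sums: "(\<lambda>n. z ^ n / fact n) sums exp z" for z :: real
    using exp_converges[of z] by (simp add: field_simps)
  \<comment> \<open>Strict monotonicity alone does not keep the epochs from accumulating before t.
    The Poisson weights are the instance 1, 0, 1 of \<open>integral_E\<close>.\<close>
  have "AE \<omega> in M. \<omega> \<in> (\<Union>n. E n)"
  proof -
    have "emeasure M (\<Union>n. E n) = (\<integral>\<^sup>+\<omega>. (\<Sum>n. indicator (E n) \<omega> * 1) \<partial>M)"
    proof (subst nn_integral_indicator[symmetric], measurable, rule nn_integral_cong_AE, use disjoint in eventually_elim)
      case (elim \<omega>)
      show ?case
      proof (cases "\<exists>m. \<omega> \<in> E m")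
        case True
        then obtain m where m: "\<omega> \<in> E m" by blast
        then have "(\<Sum>n. indicator (E n) \<omega> * 1) = (1 :: ennreal)" using elim by (intro single) auto
        with m show ?thesis by (auto simp: indicator_def)
      qed simp
    qed
    also have "\<dots> = (\<Sum>n. \<integral>\<^sup>+\<omega>. indicator (E n) \<omega> * 1 \<partial>M)"
      by (rule nn_integral_suminf) measurable
    also have "\<dots> = (\<Sum>n. ennreal (exp (- (\<delta> * t)) * ((\<delta> * t) ^ n / fact n)))"
    proof (rule suminf_cong)
      fix n
      have "(\<integral>\<^sup>+\<omega>. indicator (E n) \<omega> * 1 \<partial>M) = (\<integral>\<^sup>+\<omega>. indicator {\<omega>. \<tau> n \<omega> \<le> t \<and> t < \<tau> (Suc n) \<omega>} \<omega> *
          ennreal (accumulated 1 0 1 (\<lambda>i. \<tau> i \<omega> - \<tau> (i - 1) \<omega>) n + 0 * (t - \<tau> n \<omega>)) \<partial>M)"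
        by (intro nn_integral_cong) (auto simp: accumulated_const E_def indicator_def)
      then show "(\<integral>\<^sup>+\<omega>. indicator (E n) \<omega> * 1 \<partial>M) = ennreal (exp (- (\<delta> * t)) * ((\<delta> * t) ^ n / fact n))"
        using integral_E[of 1 0 1 n] by simp
    qed
    also have "\<dots> = ennreal (exp (- (\<delta> * t)) * exp (\<delta> * t))"
      by (intro suminf_ennreal_eq sums_mult exp_sums) (use \<delta> t in simp)
    finally have "emeasure M (\<Union>n. E n) = 1" by (simp flip: exp_add)
    then have "prob (\<Union>n. E n) = 1" by (simp add: measure_def)
    then show ?thesis by (rule AE_prob_1)
  qed
  with disjoint have "AE \<omega> in M. ennreal (sample_variance N (\<lambda>k. x k t \<omega>)) =
      (\<Sum>n. indicator (E n) \<omega> * ennreal (sample_variance N (\<lambda>k. x k t \<omega>)))"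
  proof eventually_elim
    case (elim \<omega>)
    then obtain m where "\<omega> \<in> E m" by blast
    with elim show ?case by (intro single[symmetric]) auto
  qed
  then have "mean_variance M N x t =
      (\<integral>\<^sup>+\<omega>. (\<Sum>n. indicator (E n) \<omega> * ennreal (sample_variance N (\<lambda>k. x k t \<omega>))) \<partial>M)"
    unfolding mean_variance_def by (rule nn_integral_cong_AE)
  also have "\<dots> = (\<Sum>n. \<integral>\<^sup>+\<omega>. indicator (E n) \<omega> * ennreal (sample_variance N (\<lambda>k. x k t \<omega>)) \<partial>M)"
    using x_measurable t
    by (intro nn_integral_suminf borel_measurable_times_ennreal measurable_compose[OF _ measurable_ennreal]
      sample_variance_measurable) auto
  also have "\<dots> = (\<Sum>n. ennreal (exp (- (\<delta> * t)) * ((\<delta> * retention * t) ^ n / fact n * v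
       + \<sigma>\<^sup>2 * \<delta> ^ n * t ^ Suc n / fact (Suc n) * (\<Sum>i\<le>n. retention ^ i))))"
  proof (rule suminf_cong)
    fix n
    have "(\<integral>\<^sup>+\<omega>. indicator (E n) \<omega> * ennreal (sample_variance N (\<lambda>k. x k t \<omega>)) \<partial>M) =
        (\<integral>\<^sup>+\<omega>. indicator {\<omega>. \<tau> n \<omega> \<le> t \<and> t < \<tau> (Suc n) \<omega>} \<omega> * ennreal (sample_variance N (\<lambda>k. x k t \<omega>)) \<partial>M)"
      by (intro nn_integral_cong) (auto simp: E_def indicator_def)
    then show "(\<integral>\<^sup>+\<omega>. indicator (E n) \<omega> * ennreal (sample_variance N (\<lambda>k. x k t \<omega>)) \<partial>M) =
        ennreal (exp (- (\<delta> * t)) * ((\<delta> * retention * t) ^ n / fact n * v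
       + \<sigma>\<^sup>2 * \<delta> ^ n * t ^ Suc n / fact (Suc n) * (\<Sum>i\<le>n. retention ^ i)))"
      using nn_integral_sample_variance_between_epochs[OF N t v, of n]
        integral_E[OF retention_nonneg[OF N] _ v(2), of "\<sigma>\<^sup>2" n] by simp
  qed
  also have "\<dots> = ennreal (exp (- (\<delta> * t)) * (exp (\<delta> * retention * t) * v
       + \<sigma>\<^sup>2 / \<theta> * ((exp (\<delta> * t) - 1) - (exp (\<delta> * retention * t) - 1))))"
  proof (rule suminf_ennreal_eq)
    have "real N * (real N - 1) > 0" using N by simp
    then have \<theta>: "\<theta> > 0" "\<theta> = \<delta> * (1 - retention)"
      using \<delta> by (simp_all add: \<theta>_def retention_def)
    then have ne: "retention \<noteq> 1" by auto
    have shifted: "(\<lambda>n. z ^ Suc n / fact (Suc n)) sums (exp z - 1)" for z :: real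
      using exp_sums[of z] by (subst sums_Suc_iff) simp
    \<comment> \<open>Summing the geometric progression produces the denominator
      \<open>1 - retention\<close>, which is \<open>\<theta> / \<delta>\<close>, and leaves the
      difference of two exponential series without their constant terms.\<close>
    have eq: "\<sigma>\<^sup>2 * \<delta> ^ n * t ^ Suc n / fact (Suc n) * (\<Sum>i\<le>n. retention ^ i) =
        \<sigma>\<^sup>2 / \<theta> * ((\<delta> * t) ^ Suc n / fact (Suc n) - (\<delta> * retention * t) ^ Suc n / fact (Suc n))" for n
    proof -
      have "(\<Sum>i\<le>n. retention ^ i) = (1 - retention ^ Suc n) / (1 - retention)"
        using sum_gp0[of retention n] ne by simp
      then have "\<sigma>\<^sup>2 * \<delta> ^ n * t ^ Suc n / fact (Suc n) * (\<Sum>i\<le>n. retention ^ i) =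
          \<sigma>\<^sup>2 * (\<delta> * \<delta> ^ n) * t ^ Suc n / fact (Suc n) * (1 - retention ^ Suc n) / (\<delta> * (1 - retention))"
        using \<delta> by (simp del: power_Suc fact_Suc)
      also have "\<dots> = \<sigma>\<^sup>2 / \<theta> * ((\<delta> * t) ^ Suc n / fact (Suc n) - (\<delta> * retention * t) ^ Suc n / fact (Suc n))"
        unfolding \<theta>(2) power_mult_distrib power_Suc[of \<delta>, symmetric]
        by (simp add: algebra_simps diff_divide_distrib del: power_Suc fact_Suc)
      finally show ?thesis .
    qed
    show "(\<lambda>n. exp (- (\<delta> * t)) * ((\<delta> * retention * t) ^ n / fact n * v
        + \<sigma>\<^sup>2 * \<delta> ^ n * t ^ Suc n / fact (Suc n) * (\<Sum>i\<le>n. retention ^ i))) sums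
        (exp (- (\<delta> * t)) * (exp (\<delta> * retention * t) * v
       + \<sigma>\<^sup>2 / \<theta> * ((exp (\<delta> * t) - 1) - (exp (\<delta> * retention * t) - 1))))"
      unfolding eq by (intro sums_mult sums_add sums_diff sums_mult2 shifted exp_sums)
    show "0 \<le> exp (- (\<delta> * t)) * ((\<delta> * retention * t) ^ n / fact n * v
        + \<sigma>\<^sup>2 * \<delta> ^ n * t ^ Suc n / fact (Suc n) * (\<Sum>i\<le>n. retention ^ i))" for n
      using retention_nonneg[OF N] \<delta> t v(2)
      by (auto intro!: mult_nonneg_nonneg add_nonneg_nonneg divide_nonneg_nonneg sum_nonneg)
  qed
  also have "exp (- (\<delta> * t)) * (exp (\<delta> * retention * t) * v
       + \<sigma>\<^sup>2 / \<theta> * ((exp (\<delta> * t) - 1) - (exp (\<delta> * retention * t) - 1))) =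
      exp (- (\<theta> * t)) * v + \<sigma>\<^sup>2 * (1 - exp (- (\<theta> * t))) / \<theta>"
  proof -
    have "- (\<delta> * t) + \<delta> * retention * t = - (\<theta> * t)"
      by (simp add: \<theta>_def retention_def algebra_simps)
    then have "exp (- (\<delta> * t)) * exp (\<delta> * retention * t) = exp (- (\<theta> * t))"
      by (simp flip: exp_add)
    moreover have "exp (- (\<delta> * t)) * exp (\<delta> * t) = 1"
      by (simp flip: exp_add)
    moreover have "a * (b * v + s / w * ((d - 1) - (b - 1))) = (a * b) * v + s * (a * d - a * b) / w"
      for a b d s w :: real
      by (simp add: algebra_simps diff_divide_distrib)
    ultimately show ?thesis by (simp only:)
  qed
  finally show ?thesis .
qed

end

section \<open>Asymptotics as N tends to infinity\<close>

text \<open>With u = theta t, the closed form divided by t(N) is a vanishing initial term plus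
  sigma^2 (1 - exp(-u)) / u; regimes I and II are the limits of this quotient for u tending to 0 and
  to c. Regime III divides by N^2 instead, where theta N^2 tends to 2 delta and exp(-u)
  vanishes.\<close>

theorem theorem4:
  fixes \<sigma> \<delta> \<kappa> :: real
    and M :: "nat \<Rightarrow> 'a measure"
    and B x :: "nat \<Rightarrow> nat \<Rightarrow> real \<Rightarrow> 'a \<Rightarrow> real"
    and \<tau> :: "nat \<Rightarrow> nat \<Rightarrow> 'a \<Rightarrow> real"
    and p :: "nat \<Rightarrow> nat \<Rightarrow> 'a \<Rightarrow> nat \<times> nat"
    and R :: "nat \<Rightarrow> real \<Rightarrow> ennreal"
    and t :: "nat \<Rightarrow> real"
  assumes "\<sigma> > 0" and "\<delta> > 0" and "\<kappa> = 2"
    and "\<And>N. N \<ge> 2 \<Longrightarrow> synchronized_particles (M N) N (B N) \<sigma> \<delta> (\<tau> N) (p N) (x N)"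
    and "\<And>N s. R N s = mean_variance (M N) N (x N) s"
    and "(SUP N\<in>{2..}. R N 0) < \<infinity>"
    and "filterlim t at_top at_top"
  shows "((\<lambda>N. t N / (real N)\<^sup>2) \<longlonglongrightarrow> 0 \<longrightarrow>
          (\<lambda>N. enn2real (R N (t N))) \<sim>[at_top] (\<lambda>N. \<sigma>\<^sup>2 * t N))
    \<and> (\<forall>c>0. (\<forall>N\<ge>2. t N = c * (real N)\<^sup>2 / (\<kappa> * \<delta>)) \<longrightarrow>
          (\<lambda>N. enn2real (R N (t N))) \<sim>[at_top] (\<lambda>N. (1 - exp (- c)) / c * \<sigma>\<^sup>2 * t N))
    \<and> (filterlim (\<lambda>N. t N / (real N)\<^sup>2) at_top at_top \<longrightarrow>
          (\<lambda>N. enn2real (R N (t N))) \<sim>[at_top] (\<lambda>N. \<sigma>\<^sup>2 / (\<kappa> * \<delta>) * (real N)\<^sup>2))"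
proof -
  note \<sigma> = assms(1) and \<delta> = assms(2) and \<kappa> = assms(3) and particles = assms(4)
    and R_def = assms(5) and t_lim = assms(7)
  define r v \<theta> u where "r N = enn2real (R N (t N))" and "v N = enn2real (R N 0)"
    and "\<theta> N = 2 * \<delta> / (real N * (real N - 1))" and "u N = \<theta> N * t N" for N
  define C where "C = enn2real (SUP N\<in>{2..}. R N 0)"
  have v: "R N 0 = ennreal (v N)" "0 \<le> v N" "v N \<le> C" if "N \<ge> 2" for N
  proof -
    have le: "R N 0 \<le> (SUP N\<in>{2..}. R N 0)" using that by (intro SUP_upper) auto
    then show "R N 0 = ennreal (v N)" using assms(6) by (simp add: v_def)
    show "v N \<le> C" unfolding v_def C_def using le assms(6) by (intro enn2real_mono) auto
  qed (simp add: v_def)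
  have t_pos: "\<forall>\<^sub>F N in sequentially. t N > 0"
    using t_lim by (simp add: filterlim_at_top_dense)
  have r_eq: "r N = exp (- u N) * v N + \<sigma>\<^sup>2 * (1 - exp (- u N)) / \<theta> N"
    and u_pos: "u N > 0" and \<theta>_pos: "\<theta> N > 0"
    and u_eq: "u N = 2 * \<delta> * (t N / (real N)\<^sup>2) * (real N / (real N - 1))"
    if "N \<ge> 2" "t N > 0" for N
  proof -
    interpret synchronized_particles "M N" N "B N" \<sigma> \<delta> "\<tau> N" "p N" "x N"
      by (rule particles) fact
    show pos: "\<theta> N > 0" "u N > 0" using that \<delta> by (simp_all add: \<theta>_def u_def)
    then have "0 \<le> exp (- u N) * v N + \<sigma>\<^sup>2 * (1 - exp (- u N)) / \<theta> N"
      using v(2)[OF that(1)] by simp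
    then show "r N = exp (- u N) * v N + \<sigma>\<^sup>2 * (1 - exp (- u N)) / \<theta> N"
      using mean_variance_formula[OF that(1) \<delta> _ _ v(2)[OF that(1)], of "t N"] v(1)[OF that(1)] that(2)
      by (simp add: r_def R_def u_def \<theta>_def)
    show "u N = 2 * \<delta> * (t N / (real N)\<^sup>2) * (real N / (real N - 1))"
      using that(1) by (simp add: u_def \<theta>_def power2_eq_square)
  qed
  have large: "\<forall>\<^sub>F N in sequentially. N \<ge> 2 \<and> t N > 0"
    using t_pos eventually_ge_at_top[of 2] by eventually_elim simp
  have ratio1: "(\<lambda>N. real N / (real N - 1)) \<longlonglongrightarrow> 1" and ratio2: "(\<lambda>N. (real N - 1) / real N) \<longlonglongrightarrow> 1"
    by real_asymp+
  \<comment> \<open>The uniform bound on the initial variances enters here; \<open>s\<close> will be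
    t(N) or N^2.\<close>
  have initial: "(\<lambda>N. exp (- u N) * v N / s N) \<longlonglongrightarrow> 0" if s: "filterlim s at_top sequentially" for s
  proof (rule tendsto_sandwich[OF _ _ tendsto_const])
    have s_pos: "\<forall>\<^sub>F N in sequentially. s N > 0"
      using s by (simp add: filterlim_at_top_dense)
    show "\<forall>\<^sub>F N in sequentially. 0 \<le> exp (- u N) * v N / s N"
      using large s_pos by eventually_elim (simp add: v)
    show "\<forall>\<^sub>F N in sequentially. exp (- u N) * v N / s N \<le> C / s N"
      using large s_pos
    proof eventually_elim
      case (elim N)
      then have "exp (- u N) * v N \<le> 1 * C"
        using v[of N] u_pos[of N] by (intro mult_mono) auto
      then show ?case using elim by (simp add: divide_right_mono)
    qed
    show "(\<lambda>N. C / s N) \<longlonglongrightarrow> 0"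
      by (rule real_tendsto_divide_at_top[OF tendsto_const s])
  qed
  have by_t: "(\<lambda>N. r N / t N) \<longlonglongrightarrow> \<sigma>\<^sup>2 * q"
    if q: "(\<lambda>N. (1 - exp (- u N)) / u N) \<longlonglongrightarrow> q" for q
  proof (rule Lim_transform_eventually)
    show "(\<lambda>N. exp (- u N) * v N / t N + \<sigma>\<^sup>2 * ((1 - exp (- u N)) / u N)) \<longlonglongrightarrow> \<sigma>\<^sup>2 * q"
      using tendsto_add[OF initial[OF t_lim] tendsto_mult[OF tendsto_const[of "\<sigma>\<^sup>2"] q]] by simp
    show "\<forall>\<^sub>F N in sequentially. exp (- u N) * v N / t N + \<sigma>\<^sup>2 * ((1 - exp (- u N)) / u N) = r N / t N"
      using large by eventually_elim (simp add: r_eq add_divide_distrib u_def)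
  qed
  have I: "(\<lambda>N. r N) \<sim>[at_top] (\<lambda>N. \<sigma>\<^sup>2 * t N)" if lim: "(\<lambda>N. t N / (real N)\<^sup>2) \<longlonglongrightarrow> 0"
  proof (rule asymp_equivI'_const)
    have "(\<lambda>N. 2 * \<delta> * (t N / (real N)\<^sup>2) * (real N / (real N - 1))) \<longlonglongrightarrow> 2 * \<delta> * 0 * 1"
      by (intro tendsto_intros lim ratio1)
    then have "u \<longlonglongrightarrow> 0"
      by (rule Lim_transform_eventually[THEN tendsto_eq_rhs])
         (use large in \<open>auto elim!: eventually_mono simp: u_eq\<close>)
    \<comment> \<open>Convergence through nonzero values is required: (1 - exp(-z)) / z has limit 1
      at 0, but its value there is 0 by the convention for division.\<close>
    then have u0: "filterlim u (at 0) sequentially"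
      unfolding filterlim_at using large by (auto elim!: eventually_mono dest: u_pos)
    have "((\<lambda>z. (1 - exp (- z)) / z) \<longlongrightarrow> (1::real)) (at 0)" by real_asymp
    from by_t[OF filterlim_compose[OF this u0]] show "(\<lambda>N. r N / t N) \<longlonglongrightarrow> \<sigma>\<^sup>2" by simp
  qed (use \<sigma> in simp)
  have II: "(\<lambda>N. r N) \<sim>[at_top] (\<lambda>N. (1 - exp (- c)) / c * \<sigma>\<^sup>2 * t N)"
    if c: "c > 0" and tc: "\<forall>N\<ge>2. t N = c * (real N)\<^sup>2 / (\<kappa> * \<delta>)" for c
  proof (rule asymp_equivI'_const)
    \<comment> \<open>The prescribed time scales with N^2 while \<open>\<theta>\<close> carries N (N
      - 1), so u equals c N / (N - 1) and reaches c only in the limit.\<close>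
    have "(\<lambda>N. c * (real N / (real N - 1))) \<longlonglongrightarrow> c * 1"
      by (intro tendsto_intros ratio1)
    moreover have "\<forall>\<^sub>F N in sequentially. c * (real N / (real N - 1)) = u N"
      using large
    proof eventually_elim
      case (elim N)
      then have "t N / (real N)\<^sup>2 = c / (2 * \<delta>)" using tc \<kappa> by simp
      then show ?case using elim \<delta> u_eq[of N] by simp
    qed
    ultimately have "u \<longlonglongrightarrow> c" by (simp add: Lim_transform_eventually)
    then have "(\<lambda>N. (1 - exp (- u N)) / u N) \<longlonglongrightarrow> (1 - exp (- c)) / c"
      using c by (intro tendsto_intros) auto
    from by_t[OF this] show "(\<lambda>N. r N / t N) \<longlonglongrightarrow> (1 - exp (- c)) / c * \<sigma>\<^sup>2"
      by (simp add: mult.commute)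
  qed (use \<sigma> c in simp)
  have III: "(\<lambda>N. r N) \<sim>[at_top] (\<lambda>N. \<sigma>\<^sup>2 / (\<kappa> * \<delta>) * (real N)\<^sup>2)"
    if lim: "filterlim (\<lambda>N. t N / (real N)\<^sup>2) at_top at_top"
  proof (rule asymp_equivI'_const)
    have "filterlim (\<lambda>N. 2 * \<delta> * (real N / (real N - 1)) * (t N / (real N)\<^sup>2)) at_top sequentially"
      by (rule filterlim_tendsto_pos_mult_at_top[OF tendsto_mult[OF tendsto_const ratio1] _ lim])
         (use \<delta> in simp)
    moreover have "\<forall>\<^sub>F N in sequentially. 2 * \<delta> * (real N / (real N - 1)) * (t N / (real N)\<^sup>2) = u N"
      using large by eventually_elim (simp add: u_eq mult_ac)
    ultimately have "filterlim u at_top sequentially"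
      using filterlim_cong[OF refl refl] by fast
    then have exp_u: "(\<lambda>N. exp (- u N)) \<longlonglongrightarrow> 0"
      by (intro filterlim_compose[OF exp_at_bot] filterlim_compose[OF filterlim_uminus_at_bot_at_top])
    have squares: "filterlim (\<lambda>N. (real N)\<^sup>2) at_top sequentially" by real_asymp
    \<comment> \<open>The last factors come from the exact identity 1 / (theta N^2) = (N - 1) / (2
      delta N).\<close>
    have "(\<lambda>N. exp (- u N) * v N / (real N)\<^sup>2 + \<sigma>\<^sup>2 * (1 - exp (- u N)) / (2 * \<delta>) * ((real N - 1) / real N))
        \<longlonglongrightarrow> 0 + \<sigma>\<^sup>2 * (1 - 0) / (2 * \<delta>) * 1"
      using \<delta> by (intro tendsto_intros initial squares ratio2 exp_u) auto
    moreover have "\<forall>\<^sub>F N in sequentially. exp (- u N) * v N / (real N)\<^sup>2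
        + \<sigma>\<^sup>2 * (1 - exp (- u N)) / (2 * \<delta>) * ((real N - 1) / real N) = r N / (real N)\<^sup>2"
      using large
    proof eventually_elim
      case (elim N)
      then have "1 / \<theta> N / (real N)\<^sup>2 = 1 / (2 * \<delta>) * ((real N - 1) / real N)"
        by (simp add: \<theta>_def power2_eq_square)
      moreover have "r N / (real N)\<^sup>2 = exp (- u N) * v N / (real N)\<^sup>2
          + \<sigma>\<^sup>2 * (1 - exp (- u N)) * (1 / \<theta> N / (real N)\<^sup>2)"
        using elim by (simp add: r_eq add_divide_distrib)
      ultimately show ?case by simp
    qed
    ultimately show "(\<lambda>N. r N / (real N)\<^sup>2) \<longlonglongrightarrow> \<sigma>\<^sup>2 / (\<kappa> * \<delta>)"
      using \<kappa> by (simp add: Lim_transform_eventually)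
  qed (use \<sigma> \<delta> \<kappa> in simp)
  show ?thesis
    using I II III unfolding r_def by blast
qed

end
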